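(* Let $m \geq 1$ be an integer. The following (i), (ii) hold. (i) For $n \in \mathbb{N}$, the coefficient of $t^n$ in $\tilde{G}(-q^{m-1}t) \star \tilde{G}(-q^{m-3}t) \star \cdots \star \tilde{G}(-q^{1-m}t)$, and likewise the coefficient of $t^n$ in $\exp\left(-\sum_{k=1}^\infty \frac{[mk]_q}{k}xC_{k-1}yt^k\right)$, is $$\sum a_1a_2 \cdots a_{2n}\prod_{i=1}^{2n}[\overline{a}_1+\overline{a}_2+\cdots+\overline{a}_{i-1}-m(\overline{a}_i+1)/2]_q,$$ where the sum is over all Catalan words $a_1a_2 \cdots a_{2n}$ of length $2n$. (ii) For $n \in \mathbb{N}$, the coefficient of $t^n$ in $D(-q^{m-1}t) \star D(-q^{m-3}t) \star \cdots \star D(-q^{1-m}t)$, and likewise the coefficient of $t^n$ in $\exp\left(\sum_{k=1}^\infty \frac{[mk]_q}{k}xC_{k-1}yt^k\right)$, is $$\sum a_1a_2 \cdots a_{2n}\prod_{i=1}^{2n}[\overline{a}_1+\overline{a}_2+\cdots+\overline{a}_{i-1}+m(\overline{a}_i+1)/2]_q,$$ where the sum is over all Catalan words $a_1a_2 \cdots a_{2n}$ of length $2n$. Here the exponential power series are computed with respect to the $q$-shuffle product $\star$.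
   Context: Let $\mathbb{F}$ be a field of characteristic zero and let $q \in \mathbb{F}$ be nonzero and not a root of unity. $\mathbb{N}=\{0,1,2,\ldots\}$. For $n \in \mathbb{Z}$, $[n]_q=\frac{q^n-q^{-n}}{q-q^{-1}}$. $\mathbb{V}$ is the free associative unital $\mathbb{F}$-algebra on noncommuting letters $x,y$; the words (products of letters, including the empty word $\mathbf{1}$) form a basis, and juxtaposition denotes the free product. The $q$-shuffle product $\star$ is the associative bilinear product on $\mathbb{V}$ determined by $\mathbf{1}\star v=v\star\mathbf{1}=v$ and, for nonempty words $u=u_1\cdots u_r$, $v=v_1\cdots v_s$, $$u \star v=u_1((u_2 \cdots u_r) \star v)+v_1(u \star (v_2 \cdots v_s))\,q^{\langle v_1,u_1 \rangle+\cdots+\langle v_1,u_r \rangle},$$ where $\langle x,x\rangle=\langle y,y\rangle=2$ and $\langle x,y\rangle=\langle y,x\rangle=-2$. It extends to formal power series in the (central) indeterminate $t$ with coefficients in $\mathbb{V}$. Set $\overline{x}=1$, $\overline{y}=-1$. A word $a_1\cdots a_n$ is Catalan if $\overline{a}_1+\cdots+\overline{a}_i\geq 0$ for $1\leq i\leq n-1$ and $\overline{a}_1+\cdots+\overline{a}_n=0$ (the empty word is Catalan; Catalan words have even length). For $n\in\mathbb{N}$, $C_n=\sum a_1a_2\cdots a_{2n}\prod_{i=1}^{2n}[1+\overline{a}_1+\overline{a}_2+\cdots+\overline{a}_i]_q$, the sum being over all Catalan words of length $2n$ (so $C_0=\mathbf{1}$). The element $xC_{k-1}y$ is formed with the free product.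 $\tilde{G}_n=(xy)^n$ (free-product power, $\tilde{G}_0=\mathbf{1}$), $\tilde{G}(t)=\sum_{n\in\mathbb{N}}\tilde{G}_nt^n$, and $D(t)=\sum_{n\in\mathbb{N}}D_nt^n$ is the multiplicative inverse of $\tilde{G}(t)$ with respect to $\star$: $\tilde{G}(t)\star D(t)=\mathbf{1}=D(t)\star\tilde{G}(t)$. $\exp(z)=\sum_{n\in\mathbb{N}} z^n/n!$. *)

theory Defs
  imports
    Complex_Main
    "HOL-Library.Poly_Mapping"
    "HOL-Computational_Algebra.Formal_Power_Series"
begin

section \<open>The free algebra on two letters\<close>

datatype letter = Lx | Ly

type_synonym word = "letter list"

text \<open>
  Words form a monoid under concatenation. With this instance, Poly_Mapping makes the
  finitely supported functions from words to a field into a ring: its multiplication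
  \<open>*\<close> (and the power \<open>^\<close>) is the free product, and its unit \<open>1\<close> is the empty word.
\<close>

instantiation list :: (type) monoid_add
begin

definition zero_list :: "'a list" where "zero_list = []"

definition plus_list :: "'a list \<Rightarrow> 'a list \<Rightarrow> 'a list" where "plus_list = append"

instance
  by standard (simp_all add: zero_list_def plus_list_def)

end

type_synonym 'a free_alg = "word \<Rightarrow>\<^sub>0 'a"

definition of_word :: "word \<Rightarrow> 'a::field free_alg" where
  "of_word w = Poly_Mapping.single w 1"

definition scale :: "'a::field \<Rightarrow> 'a free_alg \<Rightarrow> 'a free_alg" where
  "scale c f = Poly_Mapping.map ((*) c) f"

lemma of_word_Nil: "of_word [] = 1"
  by (simp add: of_word_def single_one flip: zero_list_def)

lemma of_word_mult: "of_word u * of_word v = of_word (u @ v)"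
  by (simp add: of_word_def mult_single plus_list_def)

lemma lookup_scale [simp]:
  "Poly_Mapping.lookup (scale c f) w = c * Poly_Mapping.lookup f w"
  by (simp add: scale_def map.rep_eq when_def)


section \<open>The \<open>q\<close>-shuffle product\<close>

fun pairing :: "letter \<Rightarrow> letter \<Rightarrow> int" where
  "pairing a b = (if a = b then 2 else - 2)"

fun qshuffle_word :: "'a::field \<Rightarrow> word \<Rightarrow> word \<Rightarrow> 'a free_alg" where
  "qshuffle_word q [] v = of_word v"
| "qshuffle_word q (a # u) [] = of_word (a # u)"
| "qshuffle_word q (a # u) (b # v) =
     of_word [a] * qshuffle_word q u (b # v) +
     scale (q powi (\<Sum>c\<leftarrow>a # u. pairing b c)) (of_word [b] * qshuffle_word q (a # u) v)"

definition qshuffle :: "'a::field \<Rightarrow> 'a free_alg \<Rightarrow> 'a free_alg \<Rightarrow> 'a free_alg" where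
  "qshuffle q f g =
     (\<Sum>u\<in>Poly_Mapping.keys f. \<Sum>v\<in>Poly_Mapping.keys g.
        scale (Poly_Mapping.lookup f u * Poly_Mapping.lookup g v) (qshuffle_word q u v))"


section \<open>Power series over the \<open>q\<close>-shuffle algebra\<close>

text \<open>
  The library product \<open>*\<close> on \<open>'a free_alg fps\<close> is the Cauchy product for the free product,
  so the operations for the \<open>q\<close>-shuffle product are defined separately. The unit series
  \<open>1\<close> is the same for both products.
\<close>

definition fps_qshuffle ::
  "'a::field \<Rightarrow> 'a free_alg fps \<Rightarrow> 'a free_alg fps \<Rightarrow> 'a free_alg fps" where
  "fps_qshuffle q f g = Abs_fps (\<lambda>n. \<Sum>i\<le>n. qshuffle q (fps_nth f i) (fps_nth g (n - i)))"

definition fps_scale :: "'a::field \<Rightarrow> 'a free_alg fps \<Rightarrow> 'a free_alg fps" where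
  "fps_scale c f = Abs_fps (\<lambda>n. scale c (fps_nth f n))"

text \<open>The substitution of \<open>c t\<close> for \<open>t\<close>.\<close>

definition fps_dilate :: "'a::field \<Rightarrow> 'a free_alg fps \<Rightarrow> 'a free_alg fps" where
  "fps_dilate c f = Abs_fps (\<lambda>n. scale (c ^ n) (fps_nth f n))"

definition fps_qshuffle_prod_list ::
  "'a::field \<Rightarrow> 'a free_alg fps list \<Rightarrow> 'a free_alg fps" where
  "fps_qshuffle_prod_list q fs = foldr (fps_qshuffle q) fs 1"

definition fps_qshuffle_power ::
  "'a::field \<Rightarrow> 'a free_alg fps \<Rightarrow> nat \<Rightarrow> 'a free_alg fps" where
  "fps_qshuffle_power q f n = fps_qshuffle_prod_list q (replicate n f)"

definition fps_qshuffle_inverse :: "'a::field \<Rightarrow> 'a free_alg fps \<Rightarrow> 'a free_alg fps" where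
  "fps_qshuffle_inverse q f =
     (THE g. fps_qshuffle q f g = 1 \<and> fps_qshuffle q g f = 1)"

text \<open>
  The infinite sum is taken in the \<open>t\<close>-adic topology of the library. It converges for
  series without constant term, and the coefficients are then the expected finite sums.
\<close>

definition fps_qshuffle_exp :: "'a::field_char_0 \<Rightarrow> 'a free_alg fps \<Rightarrow> 'a free_alg fps" where
  "fps_qshuffle_exp q f = suminf (\<lambda>n. fps_scale (1 / fact n) (fps_qshuffle_power q f n))"

lemma fps_qshuffle_power_0: "fps_qshuffle_power q f 0 = 1"
  and fps_qshuffle_power_Suc:
    "fps_qshuffle_power q f (Suc n) = fps_qshuffle q f (fps_qshuffle_power q f n)"
  by (simp_all add: fps_qshuffle_power_def fps_qshuffle_prod_list_def)

lemma fps_nth_qshuffle_power_eq_0: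
  assumes "fps_nth f 0 = 0" "k < n"
  shows "fps_nth (fps_qshuffle_power q f n) k = 0"
  using assms(2)
proof (induction n arbitrary: k)
  case (Suc n)
  have "qshuffle q (fps_nth f i) (fps_nth (fps_qshuffle_power q f n) (k - i)) = 0"
    if "i \<le> k" for i
  proof (cases "i = 0")
    case True
    then show ?thesis using assms(1) by (simp add: qshuffle_def)
  next
    case False
    with that Suc.prems have "k - i < n" by simp
    from Suc.IH[OF this] show ?thesis by (simp add: qshuffle_def)
  qed
  then show ?case by (simp add: fps_qshuffle_power_Suc fps_qshuffle_def)
qed simp

lemma fps_qshuffle_exp_sums:
  assumes "fps_nth f 0 = 0"
  shows "(\<lambda>n. fps_scale (1 / fact n) (fps_qshuffle_power q f n)) sums fps_qshuffle_exp q f"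
    and "fps_nth (fps_qshuffle_exp q f) n =
           (\<Sum>k\<le>n. scale (1 / fact k) (fps_nth (fps_qshuffle_power q f k) n))"
proof -
  let ?a = "\<lambda>n. fps_scale (1 / fact n) (fps_qshuffle_power q f n)"
  let ?E = "Abs_fps (\<lambda>n. \<Sum>k\<le>n. scale (1 / fact k) (fps_nth (fps_qshuffle_power q f k) n))"
  have nth_sum: "fps_nth (sum g A) n = (\<Sum>k\<in>A. fps_nth (g k) n)"
    for g :: "nat \<Rightarrow> 'a free_alg fps" and A n
    by (induction A rule: infinite_finite_induct) simp_all
  have scale_0: "scale c 0 = 0" for c :: 'a
    by (rule poly_mapping_eqI) simp
  have "?a sums ?E"
    unfolding sums_def
  proof (rule tendsto_fpsI)
    fix n
    show "\<forall>\<^sub>F N in sequentially. fps_nth (\<Sum>k<N. ?a k) n = fps_nth ?E n"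
    proof (rule eventually_sequentiallyI[of "Suc n"])
      fix N assume "Suc n \<le> N"
      then have "(\<Sum>k<N. fps_nth (?a k) n) = (\<Sum>k\<le>n. fps_nth (?a k) n)"
        by (intro sum.mono_neutral_right)
           (auto simp: fps_scale_def fps_nth_qshuffle_power_eq_0[OF assms] scale_0)
      then show "fps_nth (\<Sum>k<N. ?a k) n = fps_nth ?E n"
        by (simp add: nth_sum fps_scale_def)
    qed
  qed
  moreover from this have "fps_qshuffle_exp q f = ?E"
    by (simp add: fps_qshuffle_exp_def sums_iff)
  ultimately show "?a sums fps_qshuffle_exp q f"
    and "fps_nth (fps_qshuffle_exp q f) n =
           (\<Sum>k\<le>n. scale (1 / fact k) (fps_nth (fps_qshuffle_power q f k) n))"
    by simp_all
qed


section \<open>Catalan words and the series of the theorem\<close>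

definition qint :: "'a::field \<Rightarrow> int \<Rightarrow> 'a" where
  "qint q n = (q powi n - q powi (- n)) / (q - inverse q)"

fun bar :: "letter \<Rightarrow> int" where
  "bar Lx = 1"
| "bar Ly = - 1"

definition height :: "word \<Rightarrow> nat \<Rightarrow> int" where
  "height w i = (\<Sum>a\<leftarrow>take i w. bar a)"

definition catalan :: "word \<Rightarrow> bool" where
  "catalan w \<longleftrightarrow> (\<forall>i\<in>{1..length w - 1}. height w i \<ge> 0) \<and> height w (length w) = 0"

definition catalan_words :: "nat \<Rightarrow> word set" where
  "catalan_words n = {w. catalan w \<and> length w = 2 * n}"

lemma finite_catalan_words: "finite (catalan_words n)"
proof (rule finite_subset)
  have "UNIV = {Lx, Ly}" using letter.exhaust by auto
  then have "finite (UNIV :: letter set)" by (metis finite.emptyI finite.insertI)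
  then show "finite {w :: word. set w \<subseteq> UNIV \<and> length w = 2 * n}"
    by (rule finite_lists_length_eq)
qed (auto simp: catalan_words_def)

definition C_elem :: "'a::field \<Rightarrow> nat \<Rightarrow> 'a free_alg" where
  "C_elem q n = (\<Sum>w\<in>catalan_words n. scale (\<Prod>i=1..2*n. qint q (1 + height w i)) (of_word w))"

definition G_tilde :: "'a::field free_alg fps" where
  "G_tilde = Abs_fps (\<lambda>n. (of_word [Lx] * of_word [Ly]) ^ n)"

definition D_series :: "'a::field \<Rightarrow> 'a free_alg fps" where
  "D_series q = fps_qshuffle_inverse q G_tilde"

text \<open>The series \<open>F(- q\<^sup>m\<^sup>-\<^sup>1 t) \<star> F(- q\<^sup>m\<^sup>-\<^sup>3 t) \<star> \<dots> \<star> F(- q\<^sup>1\<^sup>-\<^sup>m t)\<close>, in this order.\<close>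

definition dilated_product ::
  "'a::field \<Rightarrow> nat \<Rightarrow> 'a free_alg fps \<Rightarrow> 'a free_alg fps" where
  "dilated_product q m F =
     fps_qshuffle_prod_list q
       (map (\<lambda>j. fps_dilate (- (q powi (int m - 1 - 2 * int j))) F) [0..<m])"

text \<open>The series with coefficients \<open>[mk]\<^sub>q / k \<cdot> x C\<^sub>k\<^sub>-\<^sub>1 y\<close> for \<open>k \<ge> 1\<close>.\<close>

definition xCy_series :: "'a::field_char_0 \<Rightarrow> nat \<Rightarrow> 'a free_alg fps" where
  "xCy_series q m =
     Abs_fps (\<lambda>k. if k = 0 then 0
       else scale (qint q (int (m * k)) / of_nat k) (of_word [Lx] * C_elem q (k - 1) * of_word [Ly]))"

text \<open>
  In the sum below, \<open>s = - 1\<close> for part (i) and \<open>s = 1\<close> for part (ii). Words are indexed from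
  \<open>0\<close>, so \<open>w ! (i - 1)\<close> is the \<open>i\<close>-th letter; the integer division by \<open>2\<close> is exact
  because \<open>bar a + 1\<close> is \<open>0\<close> or \<open>2\<close>.
\<close>

definition catalan_sum :: "'a::field \<Rightarrow> int \<Rightarrow> nat \<Rightarrow> nat \<Rightarrow> 'a free_alg" where
  "catalan_sum q s m n =
     (\<Sum>w\<in>catalan_words n.
        scale (\<Prod>i=1..2*n. qint q (height w (i - 1) + s * (int m * (bar (w ! (i - 1)) + 1) div 2)))
              (of_word w))"

end

theory Submission
  imports Defs "HOL-Computational_Algebra.Polynomial"
begin

text \<open>
  Let \<open>[z; h] = (z q\<^sup>h - z\<^sup>-\<^sup>1 q\<^sup>-\<^sup>h) / (q - q\<^sup>-\<^sup>1)\<close> and let \<open>S\<^sub>z(t)\<close> be the sum of all Catalan words,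
  where a letter \<open>x\<close> leaving height \<open>h\<close> contributes \<open>[z; h] t\<close> and a letter \<open>y\<close> leaving height \<open>h\<close>
  contributes \<open>[h]\<close>. The sums of the theorem are \<open>S\<^sub>z\<close> for \<open>z = q\<^sup>m\<close> and \<open>z = q\<^sup>-\<^sup>m\<close>;
  moreover \<open>G(- t) = S\<^sub>z(t)\<close> for \<open>z = q\<^sup>-\<^sup>1\<close>.

  Removing the first letter of a word is a skew derivation of the \<open>q\<close>-shuffle product, and the
  two such derivations act on the sums over paths that start at height \<open>h\<close> like the generators of
  \<open>U\<^sub>q(sl\<^sub>2)\<close> on a Verma module. The lowest vector of a tensor product of two Verma modules
  generates a Verma module, which gives \<open>S\<^sub>z(w\<^sup>-\<^sup>1 t) \<star> S\<^sub>w(z t) = S\<^sub>z\<^sub>w(t)\<close>; reversing words while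
  exchanging the letters gives the opposite order of the factors. The product formulas and
  \<open>D(- t) = S\<^sub>q(t)\<close> follow.

  Differentiating these identities at \<open>w = 1\<close>, where \<open>S\<^sub>w\<close> has derivative
  \<open>X(t) = 2 / (q - q\<^sup>-\<^sup>1) \<Sum> x C\<^sub>k\<^sub>-\<^sub>1 y t\<^sup>k\<close>, yields
  \<open>2 t S\<^sub>z'(t) = (X(z t) - X(z\<^sup>-\<^sup>1 t)) \<star> S\<^sub>z(t)\<close>. The coefficients of \<open>X\<close> commute with \<open>S\<^sub>z\<close>, so
  the exponential satisfies the same differential equation.
\<close>

section \<open>The q-shuffle product on functions of words\<close>

fun count_x :: "word \<Rightarrow> nat" where
  "count_x [] = 0"
| "count_x (Lx # w) = Suc (count_x w)"
| "count_x (Ly # w) = count_x w"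

lemma count_x_Cons: "count_x (a # w) = count_x [a] + count_x w"
  by (cases a) simp_all

definition letter_weight :: "letter \<Rightarrow> word \<Rightarrow> int" where
  "letter_weight a u = (\<Sum>c\<leftarrow>u. pairing a c)"

lemma weight_simps [simp]: "letter_weight a [] = 0"
    "letter_weight a (b # u) = pairing a b + letter_weight a u"
  by (simp_all add: letter_weight_def)

lemma weight_append [simp]: "letter_weight a (u @ v) = letter_weight a u + letter_weight a v"
  by (simp add: letter_weight_def)

text \<open>
  Series in \<open>t\<close> are replaced by functions on words: all series involved have a \<open>t\<^sup>n\<close> coefficient
  supported on words with \<open>n\<close> letters \<open>x\<close>, so \<open>t\<close> is recovered from the word. The coefficient
  ring is arbitrary, with \<open>Q k\<close> in the role of \<open>q\<^sup>k\<close>, to allow for infinitesimals later. The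
  recursion is the skew Leibniz rule for the removal of the first letter.
\<close>

fun star :: "(int \<Rightarrow> 'c::comm_ring_1) \<Rightarrow> (word \<Rightarrow> 'c) \<Rightarrow> (word \<Rightarrow> 'c) \<Rightarrow> word \<Rightarrow> 'c" where
  "star Q f g [] = f [] * g []"
| "star Q f g (a # w) =
     star Q (\<lambda>u. f (a # u)) g w + star Q (\<lambda>u. Q (letter_weight a u) * f u) (\<lambda>u. g (a # u)) w"

definition star_unit :: "word \<Rightarrow> 'c::comm_ring_1" where
  "star_unit w = (if w = [] then 1 else 0)"

lemma star_add_left: "star Q (\<lambda>u. f u + f' u) g w = star Q f g w + star Q f' g w"
  by (induction w arbitrary: f f' g) (simp_all add: algebra_simps)

lemma star_add_right: "star Q f (\<lambda>u. g u + g' u) w = star Q f g w + star Q f g' w"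
  by (induction w arbitrary: f g g') (simp_all add: algebra_simps)

lemma star_scale_left: "star Q (\<lambda>u. c * f u) g w = c * star Q f g w"
proof (induction w arbitrary: f g)
  case (Cons a w)
  have "star Q (\<lambda>u. Q (letter_weight a u) * (c * f u)) (\<lambda>u. g (a # u)) w =
        star Q (\<lambda>u. c * (Q (letter_weight a u) * f u)) (\<lambda>u. g (a # u)) w"
    by (simp add: mult.left_commute)
  also have "\<dots> = c * star Q (\<lambda>u. Q (letter_weight a u) * f u) (\<lambda>u. g (a # u)) w"
    by (rule Cons.IH)
  finally show ?case by (simp add: Cons.IH distrib_left)
qed simp

lemma star_scale_right: "star Q f (\<lambda>u. c * g u) w = c * star Q f g w"
  by (induction w arbitrary: f g) (simp_all add: algebra_simps)

lemma star_zero_left [simp]: "star Q (\<lambda>u. 0) g w = 0"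
  using star_scale_left[of Q 0 "\<lambda>_. 0" g w] by simp

lemma star_zero_right [simp]: "star Q f (\<lambda>u. 0) w = 0"
  using star_scale_right[of Q f 0 "\<lambda>_. 0" w] by simp

lemma star_diff_left: "star Q (\<lambda>u. f u - f' u) g w = star Q f g w - star Q f' g w"
  using star_add_left[of Q f "\<lambda>u. (-1) * f' u" g w] star_scale_left[of Q "-1" f' g w] by simp

lemma star_diff_right: "star Q f (\<lambda>u. g u - g' u) w = star Q f g w - star Q f g' w"
  using star_add_right[of Q f g "\<lambda>u. (-1) * g' u" w] star_scale_right[of Q f "-1" g' w] by simp

lemma star_sum_left: "star Q (\<lambda>u. \<Sum>i\<in>I. F i u) g w = (\<Sum>i\<in>I. star Q (F i) g w)"
  by (induction I rule: infinite_finite_induct) (simp_all add: star_add_left)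

lemma star_sum_right: "star Q f (\<lambda>u. \<Sum>i\<in>I. G i u) w = (\<Sum>i\<in>I. star Q f (G i) w)"
  by (induction I rule: infinite_finite_induct) (simp_all add: star_add_right)

text \<open>The product at \<open>w\<close> distributes the letters of \<open>w\<close> over the two
  factors, so a multiplicative function can be pulled out letter by letter. Dilations in t and the
  twists by \<open>letter_weight\<close> are of this kind.\<close>

lemma star_character:
  assumes "\<chi> [] = 1" and "\<And>a u. \<chi> (a # u) = \<chi> [a] * \<chi> u"
  shows "star Q (\<lambda>u. \<chi> u * f u) (\<lambda>u. \<chi> u * g u) w = \<chi> w * star Q f g w"
proof (induction w arbitrary: f g)
  case (Cons a w)
  have *: "(\<lambda>u. \<chi> (a # u) * h (a # u)) = (\<lambda>u. \<chi> [a] * (\<chi> u * h (a # u)))" for h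
    by (rule ext, subst assms(2)) (rule mult.assoc)
  have **: "(\<lambda>u. Q (letter_weight a u) * (\<chi> u * h u)) = (\<lambda>u. \<chi> u * (Q (letter_weight a u) * h u))" for h
    by (simp add: mult.left_commute)
  show ?case
    unfolding star.simps * ** star_scale_left star_scale_right Cons.IH
    by (simp add: assms(2)[of a w] algebra_simps)
qed (simp add: assms)

lemma star_dilate:
  "star Q (\<lambda>u. c ^ count_x u * f u) (\<lambda>u. c ^ count_x u * g u) w = c ^ count_x w * star Q f g w"
proof (rule star_character)
  show "c ^ count_x (a # u) = c ^ count_x [a] * c ^ count_x u" for a u
    by (cases a) simp_all
qed simp

text \<open>Each \<open>x\<close> of \<open>w\<close> goes to exactly one factor; this is the
  Leibniz rule for t d/dt.\<close>

lemma star_derivation: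
  "star Q (\<lambda>u. of_nat (count_x u) * f u) g w + star Q f (\<lambda>u. of_nat (count_x u) * g u) w =
     of_nat (count_x w) * star Q f g w"
proof (induction w arbitrary: f g)
  case (Cons a w)
  have *: "(\<lambda>u. of_nat (count_x (a # u)) * h (a # u)) =
      (\<lambda>u. of_nat (count_x [a]) * h (a # u) + of_nat (count_x u) * h (a # u))" for h :: "word \<Rightarrow> 'a"
    by (cases a) (simp_all add: algebra_simps)
  have **: "(\<lambda>u. Q (letter_weight a u) * (of_nat (count_x u) * h u)) =
      (\<lambda>u. of_nat (count_x u) * (Q (letter_weight a u) * h u))"
    for h
    by (simp add: mult.left_commute)
  have n: "of_nat (count_x (a # w)) = (of_nat (count_x [a]) + of_nat (count_x w) :: 'a)"
    by (cases a) simp_all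
  show ?case
    unfolding star.simps * ** star_add_left star_add_right star_scale_left star_scale_right n
    using Cons.IH[of "\<lambda>u. f (a # u)" g] Cons.IH[of "\<lambda>u. Q (letter_weight a u) * f u" "\<lambda>u. g (a # u)"]
    by (simp add: algebra_simps)
qed simp

text \<open>With fewer than \<open>i + j\<close> letters \<open>x\<close> to share, one factor
  always stays below its order. This justifies truncation by degree.\<close>

lemma star_order:
  assumes "\<And>u. count_x u < i \<Longrightarrow> f u = 0" and "\<And>u. count_x u < j \<Longrightarrow> g u = 0" and "count_x w < i + j"
  shows "star Q f g w = 0"
  using assms
proof (induction w arbitrary: f g i j)
  case Nil
  then show ?case by (cases "i = 0") auto
next
  case (Cons a w)
  have n: "count_x (a # u) = count_x [a] + count_x u" for u by (rule count_x_Cons)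
  have "star Q (\<lambda>u. f (a # u)) g w = 0"
  proof (rule Cons.IH[of "i - count_x [a]" _ j])
    show "f (a # u) = 0" if "count_x u < i - count_x [a]" for u
      using that Cons.prems(1)[of "a # u"] n[of u] by linarith
    show "count_x w < i - count_x [a] + j" using Cons.prems(3) n[of w] by linarith
  qed (use Cons.prems in auto)
  moreover have "star Q (\<lambda>u. Q (letter_weight a u) * f u) (\<lambda>u. g (a # u)) w = 0"
  proof (rule Cons.IH[of i _ "j - count_x [a]"])
    show "g (a # u) = 0" if "count_x u < j - count_x [a]" for u
      using that Cons.prems(2)[of "a # u"] n[of u] by linarith
    show "count_x w < i + (j - count_x [a])" using Cons.prems(3) n[of w] by linarith
  qed (use Cons.prems in auto)
  ultimately show ?case by simp
qed

lemma fps_nth_star: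
  "fps_nth (star (\<lambda>k. fps_const (Q k)) F G w) n =
     (\<Sum>i\<le>n. star Q (\<lambda>u. fps_nth (F u) i) (\<lambda>u. fps_nth (G u) (n - i)) w)"
proof (induction w arbitrary: F G)
  case (Cons a w)
  then show ?case by (simp add: sum.distrib)
qed (simp add: fps_mult_nth atLeast0AtMost)

lemma star_fps_const:
  "star (\<lambda>k. fps_const (Q k)) (\<lambda>u. fps_const (f u)) (\<lambda>u. fps_const (g u)) w =
     fps_const (star Q f g w)"
  by (induction w arbitrary: f g) simp_all

text \<open>Dilation by the indeterminate \<open>fps_X\<close> marks the degree; the claim is the
  coefficient of index \<open>n\<close> of the dilated product.\<close>

lemma star_graded:
  "(\<Sum>i\<le>n. star Q (\<lambda>u. if count_x u = i then f u else 0) (\<lambda>u. if count_x u = n - i then g u else 0) w) =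
     (if count_x w = n then star Q f g w else 0)"
proof -
  have *: "fps_nth (fps_X ^ count_x u * fps_const c) k = (if count_x u = k then c else 0)"
    for u :: word and c :: 'a and k
    by simp
  have "star (\<lambda>k. fps_const (Q k)) (\<lambda>u. fps_X ^ count_x u * fps_const (f u))
          (\<lambda>u. fps_X ^ count_x u * fps_const (g u)) w = fps_X ^ count_x w * fps_const (star Q f g w)"
    by (simp add: star_dilate star_fps_const)
  from arg_cong[OF this, of "\<lambda>F. fps_nth F n"] show ?thesis
    unfolding fps_nth_star * .
qed

section \<open>Associativity and the reflection of words\<close>

fun swap :: "letter \<Rightarrow> letter" where
  "swap Lx = Ly"
| "swap Ly = Lx"

text \<open>Reversal alone would turn lattice paths upside down; exchanging the letters as well
  keeps them above level 0.\<close>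

definition refl_word :: "word \<Rightarrow> word" where
  "refl_word w = rev (map swap w)"

lemma refl_word_simps:
  "refl_word [] = []" "refl_word (a # u) = refl_word u @ [swap a]"
  "refl_word (u @ [a]) = swap a # refl_word u"
  by (simp_all add: refl_word_def)

lemma weight_refl_word: "letter_weight (swap a) (refl_word u) = letter_weight a u"
proof -
  have "pairing (swap a) (swap c) = pairing a c" for c
    by (cases a; cases c) auto
  then show ?thesis
    by (induction u) (simp_all add: refl_word_simps del: pairing.simps)
qed

lemma swap_swap [simp]: "swap (swap a) = a"
  by (cases a) simp_all

locale qshuffle_alg =
  fixes Q :: "int \<Rightarrow> 'c::comm_ring_1"
  assumes Q_0 [simp]: "Q 0 = 1" and Q_add: "Q (i + j) = Q i * Q j"
begin

abbreviation star' (infixl "\<star>" 70) where "f \<star> g \<equiv> star Q f g"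

lemma star_unit_left [simp]: "star_unit \<star> g = g"
proof
  have *: "(\<lambda>u. Q (letter_weight a u) * star_unit u) = star_unit" and **: "(\<lambda>u. star_unit (a # u)) =
      (\<lambda>_. 0)"
    for a by (auto simp: star_unit_def)
  show "(star_unit \<star> g) w = g w" for w
    by (induction w arbitrary: g) (simp add: star_unit_def, simp add: * **)
qed

lemma star_unit_right [simp]: "f \<star> star_unit = f"
proof
  have **: "(\<lambda>u. star_unit (a # u)) = (\<lambda>_. 0)" for a
    by (auto simp: star_unit_def)
  show "(f \<star> star_unit) w = f w" for w
    by (induction w arbitrary: f) (simp add: star_unit_def, simp add: **)
qed

lemma star_twist:
  "star Q (\<lambda>u. Q (letter_weight a u) * f u) (\<lambda>u. Q (letter_weight a u) * g u) w =
      Q (letter_weight a w) * star Q f g w"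
  by (rule star_character) (simp_all add: Q_add)

text \<open>Removing a first letter yields the same three terms on both sides, one per factor,
  because by \<open>star_twist\<close> the twist of a product is the product of the twists.\<close>

lemma star_assoc: "(f \<star> g) \<star> h = f \<star> (g \<star> h)"
proof
  show "((f \<star> g) \<star> h) w = (f \<star> (g \<star> h)) w" for w
  proof (induction w arbitrary: f g h)
    case (Cons a w)
    have t: "(\<lambda>u. Q (letter_weight a u) * (f \<star> g) u) =
        (\<lambda>u. Q (letter_weight a u) * f u) \<star> (\<lambda>u. Q (letter_weight a u) * g u)"
      by (simp add: star_twist[symmetric] fun_eq_iff)
    show ?case
      by (simp add: star_add_left star_add_right t Cons.IH add.assoc)
  qed (simp add: mult.assoc)
qed

text \<open>The skew Leibniz rule for the removal of the last letter.\<close>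

lemma star_snoc:
  "(f \<star> g) (w @ [a]) = (f \<star> (\<lambda>u. g (u @ [a]))) w +
      ((\<lambda>u. f (u @ [a])) \<star> (\<lambda>u. Q (letter_weight a u) * g u)) w"
proof (induction w arbitrary: f g)
  case (Cons b w)
  have *: "(\<lambda>u. Q (letter_weight b u + c) * h u) = (\<lambda>u. Q c * (Q (letter_weight b u) * h u))"
          "(\<lambda>u. Q (c + letter_weight b u) * h u) = (\<lambda>u. Q c * (Q (letter_weight b u) * h u))" for h c b
    by (simp_all add: Q_add mult.assoc mult.left_commute)
  have p: "pairing a b = pairing b a" by simp
  show ?case
    by (simp add: Cons.IH * star_scale_left star_scale_right p del: pairing.simps)
qed simp

text \<open>\<open>star_snoc\<close> is the defining recursion read from the right with the factors
  exchanged, and exchanging the letters preserves the pairing.\<close>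

lemma star_refl_word:
  "(f \<star> g) (refl_word w) = ((\<lambda>u. g (refl_word u)) \<star> (\<lambda>u. f (refl_word u))) w"
proof (induction w arbitrary: f g)
  case (Cons a w)
  have "(\<lambda>u. Q (letter_weight (swap a) (refl_word u)) * g (refl_word u)) =
      (\<lambda>u. Q (letter_weight a u) * g (refl_word u))"
    by (simp add: weight_refl_word)
  then show ?case
    by (simp add: refl_word_simps star_snoc Cons.IH)
qed (simp add: refl_word_simps mult.commute)

end

section \<open>Sums over lattice paths\<close>

text \<open>Down steps are indexed by their lower end, so that \<open>A i\<close> and
  \<open>B i\<close> belong to the same edge between the levels \<open>i\<close> and
  \<open>Suc i\<close>.\<close>

fun path :: "(nat \<Rightarrow> 'c::comm_ring_1) \<Rightarrow> (nat \<Rightarrow> 'c) \<Rightarrow> nat \<Rightarrow> nat \<Rightarrow> word \<Rightarrow> 'c" where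
  "path A B h k [] = (if h = k then 1 else 0)"
| "path A B h k (Lx # w) = A h * path A B (Suc h) k w"
| "path A B 0 k (Ly # w) = 0"
| "path A B (Suc h) k (Ly # w) = B h * path A B h k w"

lemma path_snoc_Lx:
  "path A B h k (w @ [Lx]) = (case k of 0 \<Rightarrow> 0 | Suc k' \<Rightarrow> path A B h k' w * A k')"
proof (induction w arbitrary: h)
  case Nil
  then show ?case by (auto split: nat.split)
next
  case (Cons a w)
  then show ?case by (cases a; cases h) (auto split: nat.split simp: mult.assoc)
qed

lemma path_snoc_Ly: "path A B h k (w @ [Ly]) = path A B h (Suc k) w * B k"
proof (induction w arbitrary: h)
  case Nil
  then show ?case by (cases h) auto
next
  case (Cons a w)
  then show ?case by (cases a; cases h) (auto simp: mult.assoc)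
qed

text \<open>A reflected word runs through the same edges backwards, with up and down
  exchanged.\<close>

lemma path_refl_word: "path A B h k (refl_word w) = path B A k h w"
proof (induction w arbitrary: h k)
  case (Cons a w)
  then show ?case
    by (cases a; cases k)
       (auto simp: refl_word_simps path_snoc_Lx path_snoc_Ly mult.commute)
qed (simp add: refl_word_simps)

text \<open>
  Each step from \<open>i\<close> up to \<open>Suc i\<close> can be matched with a later step back, except for one step
  down from each of the initial levels below \<open>h\<close>; so only the products \<open>A i * B i\<close> matter.
\<close>

lemma path_gauge: "(\<Prod>i<h. A i) * path A B h 0 w = path (\<lambda>_. 1) (\<lambda>i. A i * B i) h 0 w"
proof (induction w arbitrary: h)
  case (Cons a w)
  show ?case
  proof (cases a)
    case Lx
    then show ?thesis using Cons.IH[of "Suc h"] by (simp add: mult.assoc)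
  next
    case Ly
    then show ?thesis using Cons.IH[of "h - 1"]
      by (cases h) (simp_all add: algebra_simps)
  qed
qed simp

text \<open>For paths from level 0 the prefactor in \<open>path_gauge\<close> is an empty product,
  and \<open>A i * B i\<close> is symmetric in \<open>A\<close> and \<open>B\<close>.\<close>

lemma path_refl_word_0: "path A B 0 0 (refl_word w) = path A B 0 0 w"
  using path_gauge[of A 0 B w] path_gauge[of B 0 A w]
  by (simp add: path_refl_word mult.commute)

lemma weight_Lx: "letter_weight Lx u = 2 * (int (count_x u) - int (count_x (refl_word u)))"
  and weight_Ly: "letter_weight Ly u = - letter_weight Lx u"
proof -
  have *: "count_x (u @ v) = count_x u + count_x v" for u v
    by (induction u rule: count_x.induct) simp_all
  show "letter_weight Ly u = - letter_weight Lx u"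
  proof (induction u)
    case (Cons a u)
    then show ?case by (cases a) simp_all
  qed simp
  show "letter_weight Lx u = 2 * (int (count_x u) - int (count_x (refl_word u)))"
  proof (induction u)
    case (Cons a u)
    then show ?case by (cases a) (simp_all add: refl_word_simps *)
  qed (simp add: refl_word_simps)
qed

lemma path_nonzero_weight: "path A B h k u \<noteq> 0 \<Longrightarrow> letter_weight Lx u = 2 * (int k - int h)"
proof (induction u arbitrary: h)
  case Nil
  then show ?case by (auto split: if_splits)
next
  case (Cons a u)
  show ?case
  proof (cases a)
    case Lx
    with Cons.prems have "path A B (Suc h) k u \<noteq> 0" by auto
    from Cons.IH[OF this] Lx show ?thesis by simp
  next
    case Ly
    with Cons.prems obtain g where "h = Suc g" "path A B g k u \<noteq> 0"
      by (cases h) (auto, fastforce)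
    with Cons.IH[OF this(2)] Ly show ?thesis by simp
  qed
qed

section \<open>Verma modules and their tensor products\<close>

text \<open>
  The second argument of \<open>bracket\<close> and \<open>verma\<close> stands for the inverse of the first one.
\<close>

locale qshuffle_bracket = qshuffle_alg Q for Q :: "int \<Rightarrow> 'c::comm_ring_1" +
  fixes \<kappa> :: 'c
begin

definition bracket :: "'c \<Rightarrow> 'c \<Rightarrow> int \<Rightarrow> 'c" where
  "bracket z z' h = \<kappa> * (z * Q h - z' * Q (- h))"

abbreviation qi :: "int \<Rightarrow> 'c" where "qi \<equiv> bracket 1 1"

lemma qi_0 [simp]: "qi 0 = 0"
  by (simp add: bracket_def)

lemma Q_mult: "Q i * Q j = Q (i + j)" "Q i * (Q j * c) = Q (i + j) * c"
  by (simp_all add: Q_add mult.assoc)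

text \<open>The mixed terms, with coefficient \<open>z * u'\<close>, cancel. The combination arises
  when \<open>y\<close> is removed from a product.\<close>

lemma bracket_add:
  "u' * (Q (- j) * bracket z z' i) + z * (Q i * bracket u u' j) = bracket (z * u) (z' * u') (i + j)"
  by (simp add: bracket_def algebra_simps Q_mult)

text \<open>All weights sit on the down steps, as \<open>path_gauge\<close> permits. Removing
  \<open>x\<close> then raises the level with coefficient 1, and removing \<open>y\<close> lowers it
  with coefficient [h] [z; h - 1], as on the standard basis of a Verma module.\<close>

definition verma :: "'c \<Rightarrow> 'c \<Rightarrow> nat \<Rightarrow> word \<Rightarrow> 'c" where
  "verma z z' h = path (\<lambda>_. 1) (\<lambda>i. qi (int i + 1) * bracket z z' (int i)) h 0"

lemma verma_simps [simp]:
  "verma z z' h [] = (if h = 0 then 1 else 0)"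
  "verma z z' h (Lx # w) = verma z z' (Suc h) w"
  "verma z z' h (Ly # w) = qi (int h) * bracket z z' (int h - 1) * verma z z' (h - 1) w"
  by (simp_all add: verma_def) (cases h; simp add: add.commute)

lemma verma_weight: "verma z z' h u \<noteq> 0 \<Longrightarrow> letter_weight Lx u = - 2 * int h \<and> letter_weight Ly u =
    2 * int h"
  using path_nonzero_weight unfolding verma_def weight_Ly by fastforce

lemma verma_refl_word: "verma z z' 0 (refl_word w) = verma z z' 0 w"
  by (simp add: verma_def path_refl_word_0)

text \<open>The \<open>q\<close>-binomial coefficient \<open>i + j\<close> over \<open>i\<close>, times \<open>q\<close> to the power \<open>- i j\<close>.\<close>

fun twisted_binomial :: "nat \<Rightarrow> nat \<Rightarrow> 'c" where
  "twisted_binomial 0 j = 1"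
| "twisted_binomial (Suc i) 0 = 1"
| "twisted_binomial (Suc i) (Suc j) = twisted_binomial i (Suc j) + Q (- 2 * (int i +
    1)) * twisted_binomial (Suc i) j"

lemma twisted_binomial_0 [simp]: "twisted_binomial i 0 = 1"
  by (cases i) simp_all

text \<open>Pascal's rule reduces each identity to both of them at a smaller pair, hence the joint
  induction. There are no quotients because brackets need not be invertible in
  \<open>'c\<close>.\<close>

lemma twisted_binomial_ratio:
  "qi (int i + 1) * twisted_binomial (Suc i) j =
      Q (- int j) * qi (int i + int j + 1) * twisted_binomial i j"
  "qi (int j + 1) * twisted_binomial i (Suc j) =
      Q (- int i) * qi (int i + int j + 1) * twisted_binomial i j"
proof (induction "i + j" arbitrary: i j rule: less_induct)
  case less
  show "qi (int i + 1) * twisted_binomial (Suc i) j =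
      Q (- int j) * qi (int i + int j + 1) * twisted_binomial i j"
  proof (cases j)
    case (Suc l)
    have 1: "qi (int i + 1) * twisted_binomial (Suc i) l =
        Q (- int l) * (qi (int i + int l + 1) * twisted_binomial i l)"
      and 2: "qi (int l + 1) * twisted_binomial i (Suc l) =
          Q (- int i) * (qi (int i + int l + 1) * twisted_binomial i l)"
      using less[of i l] Suc by (simp_all add: mult.assoc)
    \<comment> \<open>Eliminating \<open>twisted_binomial i l\<close> from 1 and 2 expresses
      everything by \<open>twisted_binomial i (Suc l)\<close>.\<close>
    have "Q (int i) * (qi (int l + 1) * twisted_binomial i (Suc l)) =
        qi (int i + int l + 1) * twisted_binomial i l"
      unfolding 2 by (simp add: Q_mult)
    then have "qi (int i + 1) * twisted_binomial (Suc i) l =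
        Q (int i - int l) * (qi (int l + 1) * twisted_binomial i (Suc l))"
      unfolding 1 by (metis Q_mult(2) add.commute uminus_add_conv_diff)
    then have "Q (- 2 * (int i + 1)) * (qi (int i + 1) * twisted_binomial (Suc i) l) =
        Q (- 2 * (int i + 1) + (int i - int l)) * (qi (int l + 1) * twisted_binomial i (Suc l))"
      by (simp only: Q_mult(2))
    also have "- 2 * (int i + 1) + (int i - int l) = - int i - int l - 2"
      by simp
    finally have "Q (- 2 * (int i + 1)) * (qi (int i + 1) * twisted_binomial (Suc i) l) =
        Q (- int i - int l - 2) * (qi (int l + 1) * twisted_binomial i (Suc l))" .
    then have "qi (int i + 1) * twisted_binomial (Suc i) j =
       (qi (int i + 1) + Q (- int i - int l - 2) * qi (int l + 1)) * twisted_binomial i (Suc l)"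
      by (simp add: Suc distrib_right distrib_left mult.assoc mult.left_commute[of "bracket _ _ _" "Q _"])
    also have "qi (int i + 1) + Q (- int i - int l - 2) * qi (int l + 1) =
        Q (- int j) * qi (int i + int j + 1)"
      by (simp add: Suc bracket_def algebra_simps Q_mult)
    finally show ?thesis by (simp add: Suc)
  qed simp
  show "qi (int j + 1) * twisted_binomial i (Suc j) =
      Q (- int i) * qi (int i + int j + 1) * twisted_binomial i j"
  proof (cases i)
    case (Suc k)
    have 1: "qi (int k + 1) * twisted_binomial (Suc k) j =
        Q (- int j) * (qi (int k + int j + 1) * twisted_binomial k j)"
      and 2: "qi (int j + 1) * twisted_binomial k (Suc j) =
          Q (- int k) * (qi (int k + int j + 1) * twisted_binomial k j)"
      using less[of k j] Suc by (simp_all add: mult.assoc)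
    have "Q (int j) * (qi (int k + 1) * twisted_binomial (Suc k) j) =
        qi (int k + int j + 1) * twisted_binomial k j"
      unfolding 1 by (simp add: Q_mult)
    then have "qi (int j + 1) * twisted_binomial k (Suc j) =
        Q (int j - int k) * (qi (int k + 1) * twisted_binomial (Suc k) j)"
      unfolding 2 by (metis Q_mult(2) add.commute uminus_add_conv_diff)
    then have "qi (int j + 1) * twisted_binomial i (Suc j) =
       (Q (int j - int k) * qi (int k + 1) + Q (- 2 * int i) * qi (int j + 1)) * twisted_binomial i j"
      by (simp add: Suc algebra_simps Q_mult)
    also have "Q (int j - int k) * qi (int k + 1) + Q (- 2 * int i) * qi (int j + 1) =
        Q (- int i) * qi (int i + int j + 1)"
      by (simp add: Suc bracket_def algebra_simps Q_mult)
         (rule arg_cong[where f = "\<lambda>t. \<kappa> * Q t"], simp)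
    finally show ?thesis .
  qed simp
qed

text \<open>
  The left side is the result of removing the letter \<open>x\<close> from the front \<open>h\<close> times, starting from
  the product for \<open>h = 0\<close>.
\<close>

lemma star_verma_general:
  fixes z z' u u' :: 'c
  defines "P \<equiv> \<lambda>i j. (\<lambda>v. u' ^ count_x v * verma z z' i v) \<star> (\<lambda>v. z ^ count_x v * verma u u' j v)"
  shows "(\<Sum>i\<le>h. u' ^ i * z ^ (h - i) * twisted_binomial i (h - i) * P i (h - i) w) =
      verma (z * u) (z' * u') h w"
proof (induction w arbitrary: h)
  case Nil
  have "P i j [] = (if i = 0 \<and> j = 0 then 1 else 0)" for i j
    by (simp add: P_def)
  then show ?case
    by (cases h) (auto intro!: sum.neutral)
next
  case (Cons a w)
  \<comment> \<open>\<open>verma z z' i\<close> lives on words of a single weight, so the twist in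
    the Leibniz rule becomes a power of q.\<close>
  have K: "(\<lambda>v. Q (letter_weight Lx v) * (u' ^ count_x v * verma z z' i v)) =
      (\<lambda>v. Q (-2 * int i) * (u' ^ count_x v * verma z z' i v))"
          "(\<lambda>v. Q (letter_weight Ly v) * (u' ^ count_x v * verma z z' i v)) =
              (\<lambda>v. Q (2 * int i) * (u' ^ count_x v * verma z z' i v))" for i
  proof -
    have *: "Q (letter_weight Lx v) * (u' ^ count_x v * verma z z' i v) =
        Q (-2 * int i) * (u' ^ count_x v * verma z z' i v) \<and>
      Q (letter_weight Ly v) * (u' ^ count_x v * verma z z' i v) = Q (2 * int i) * (u' ^ count_x v * verma z z' i v)" for v
      using verma_weight[of z z' i v] by (cases "verma z z' i v = 0") auto
    show "(\<lambda>v. Q (letter_weight Lx v) * (u' ^ count_x v * verma z z' i v)) =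
        (\<lambda>v. Q (-2 * int i) * (u' ^ count_x v * verma z z' i v))"
          "(\<lambda>v. Q (letter_weight Ly v) * (u' ^ count_x v * verma z z' i v)) =
              (\<lambda>v. Q (2 * int i) * (u' ^ count_x v * verma z z' i v))"
      using * by blast+
  qed
  define c where "c = (\<lambda>i j. u' ^ i * z ^ j * twisted_binomial i j)"
  show ?case
  proof (cases a)
    case Lx
    have Px: "P i j (Lx # w) = u' * P (Suc i) j w + z * (Q (-2 * int i) * P i (Suc j) w)" for i j
      unfolding P_def star.simps K verma_simps count_x.simps power_Suc mult.assoc star_scale_left star_scale_right
      by (simp add: mult.left_commute)
    \<comment> \<open>The recursion of \<open>twisted_binomial\<close> is made to match the two
      terms of \<open>Px\<close>.\<close>
    have cr: "c (Suc i) (Suc j) = u' * c i (Suc j) + z * (Q (-2 * (int i + 1)) * c (Suc i) j)"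
             "c 0 (Suc j) = z * c 0 j" "c (Suc i) 0 = u' * c i 0" for i j
      by (simp_all add: c_def algebra_simps)
    have "(\<Sum>i\<le>h. c i (h - i) * P i (h - i) (a # w)) =
      (\<Sum>i\<le>h. u' * c i (h - i) * P (Suc i) (h - i) w) +
      (\<Sum>i\<le>h. z * (Q (-2 * int i) * c i (h - i)) * P i (Suc h - i) w)"
      unfolding Lx Px sum.distrib[symmetric]
      by (intro sum.cong refl) (simp add: algebra_simps Suc_diff_le)
    also have "(\<Sum>i\<le>h. u' * c i (h - i) * P (Suc i) (h - i) w) =
       (\<Sum>i<h. u' * c i (h - i) * P (Suc i) (h - i) w) + c (Suc h) 0 * P (Suc h) 0 w"
      by (simp add: lessThan_Suc_atMost[symmetric] cr)
    also have "(\<Sum>i\<le>h. z * (Q (-2 * int i) * c i (h - i)) * P i (Suc h - i) w) =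
       c 0 (Suc h) * P 0 (Suc h) w + (\<Sum>i<h. z * (Q (-2 * (int i + 1)) * c (Suc i) (h - Suc i)) * P (Suc i) (h - i) w)"
      by (simp add: lessThan_Suc_atMost[symmetric] sum.lessThan_Suc_shift cr add.commute del: sum.lessThan_Suc)
    also have "(\<Sum>i<h. u' * c i (h - i) * P (Suc i) (h - i) w) + c (Suc h) 0 * P (Suc h) 0 w +
       (c 0 (Suc h) * P 0 (Suc h) w + (\<Sum>i<h. z * (Q (-2 * (int i + 1)) * c (Suc i) (h - Suc i)) * P (Suc i) (h - i) w)) =
       c 0 (Suc h) * P 0 (Suc h) w + (\<Sum>i<h. c (Suc i) (h - i) * P (Suc i) (h - i) w) + c (Suc h) 0 * P (Suc h) 0 w"
    proof -
      have "c (Suc i) (h - i) = u' * c i (h - i) + z * (Q (-2 * (int i + 1)) * c (Suc i) (h - Suc i))"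
        if "i < h" for i
        using cr(1)[of i "h - Suc i"] that by (simp add: Suc_diff_Suc)
      then have "(\<Sum>i<h. c (Suc i) (h - i) * P (Suc i) (h - i) w) =
         (\<Sum>i<h. u' * c i (h - i) * P (Suc i) (h - i) w) +
         (\<Sum>i<h. z * (Q (-2 * (int i + 1)) * c (Suc i) (h - Suc i)) * P (Suc i) (h - i) w)"
        unfolding sum.distrib[symmetric] by (intro sum.cong refl) (simp add: distrib_right)
      then show ?thesis by (simp add: algebra_simps)
    qed
    also have "\<dots> = (\<Sum>i\<le>Suc h. c i (Suc h - i) * P i (Suc h - i) w)"
      unfolding sum.atMost_Suc_shift by (simp add: lessThan_Suc_atMost[symmetric] add.assoc)
    also have "\<dots> = verma (z * u) (z' * u') (Suc h) w"
      using Cons.IH[of "Suc h"] by (simp add: c_def)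
    finally show ?thesis using Lx by (simp add: c_def)
  next
    case Ly
    have Py: "P i j (Ly # w) = qi (int i) * (bracket z z' (int i - 1) * P (i - 1) j w) +
         Q (2 * int i) * (qi (int j) * (bracket u u' (int j - 1) * P i (j - 1) w))" for i j
      unfolding P_def star.simps K verma_simps count_x.simps mult.assoc
        mult.left_commute[of "_ ^ count_x _"] star_scale_left star_scale_right
      by simp
    show ?thesis
    proof (cases h)
      case 0
      then show ?thesis by (simp add: Py Ly)
    next
      case (Suc g)
      \<comment> \<open>\<open>P i j\<close> is reached by lowering either factor. The ratios reduce
        both coefficients to \<open>c i j\<close>, and \<open>bracket_add\<close> combines the
        rest.\<close>
      have coeff: "c (Suc i) j * (qi (int i + 1) * bracket z z' (int i)) +
         c i (Suc j) * (Q (2 * int i) * (qi (int j + 1) * bracket u u' (int j))) =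
         qi (int i + int j + 1) * bracket (z * u) (z' * u') (int i + int j) * c i j" for i j
      proof -
        have Q2: "Q (int i) = Q (2 * int i) * Q (- int i)" by (simp add: Q_mult)
        have "c (Suc i) j * (qi (int i + 1) * bracket z z' (int i)) +
           c i (Suc j) * (Q (2 * int i) * (qi (int j + 1) * bracket u u' (int j))) =
           u' ^ i * z ^ j * (u' * bracket z z' (int i) * (qi (int i + 1) * twisted_binomial (Suc i) j) +
              z * Q (2 * int i) * bracket u u' (int j) * (qi (int j + 1) * twisted_binomial i (Suc j)))"
          by (simp add: c_def algebra_simps del: twisted_binomial.simps)
        also have "\<dots> = u' ^ i * z ^ j * (qi (int i + int j + 1) * twisted_binomial i j) *
            (u' * (Q (- int j) * bracket z z' (int i)) + z * (Q (int i) * bracket u u' (int j)))"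
          unfolding twisted_binomial_ratio Q2 by (simp add: algebra_simps del: twisted_binomial.simps)
        finally show ?thesis unfolding bracket_add by (simp add: c_def algebra_simps)
      qed
      have "(\<Sum>i\<le>h. c i (h - i) * P i (h - i) (a # w)) =
         (\<Sum>i\<le>Suc g. c i (Suc g - i) * (qi (int i) * (bracket z z' (int i - 1) * P (i - 1) (Suc g - i) w))) +
         (\<Sum>i\<le>Suc g. c i (Suc g - i) * (Q (2 * int i) * (qi (int (Suc g - i)) * (bracket u u' (int (Suc g - i) - 1) * P i (Suc g - i - 1) w))))"
        unfolding Ly Suc Py sum.distrib[symmetric] by (simp add: distrib_left)
      also have "(\<Sum>i\<le>Suc g. c i (Suc g - i) * (qi (int i) * (bracket z z' (int i - 1) * P (i - 1) (Suc g - i) w))) =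
         (\<Sum>i\<le>g. c (Suc i) (g - i) * (qi (int i + 1) * bracket z z' (int i)) * P i (g - i) w)"
        by (simp add: sum.atMost_Suc_shift add.commute mult.assoc del: sum.atMost_Suc)
      also have "(\<Sum>i\<le>Suc g. c i (Suc g - i) * (Q (2 * int i) * (qi (int (Suc g - i)) * (bracket u u' (int (Suc g - i) - 1) * P i (Suc g - i - 1) w)))) =
         (\<Sum>i\<le>g. c i (Suc (g - i)) * (Q (2 * int i) * (qi (int (g - i) + 1) * bracket u u' (int (g - i)))) * P i (g - i) w)"
        by (simp add: Suc_diff_le mult.assoc add.commute add_diff_eq)
      also have "(\<Sum>i\<le>g. c (Suc i) (g - i) * (qi (int i +
          1) * bracket z z' (int i)) * P i (g - i) w) + \<dots> =
         (\<Sum>i\<le>g. qi (int g + 1) * bracket (z * u) (z' * u') (int g) * (c i (g - i) * P i (g - i) w))"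
        unfolding sum.distrib[symmetric] distrib_right[symmetric] coeff
        by (intro sum.cong refl) (simp add: of_nat_diff mult.assoc)
      also have "\<dots> = qi (int g + 1) * bracket (z * u) (z' * u') (int g) * verma (z * u) (z' * u') g w"
        unfolding sum_distrib_left[symmetric] using Cons.IH[of g] by (simp add: c_def)
      finally show ?thesis by (simp add: Ly Suc c_def add.commute)
    qed
  qed
qed

lemma star_verma:
  "(\<lambda>v. u' ^ count_x v * verma z z' 0 v) \<star> (\<lambda>v. z ^ count_x v * verma u u' 0 v) =
      verma (z * u) (z' * u') 0"
  using star_verma_general[where h = 0] by (simp add: fun_eq_iff)

lemma star_verma_swap:
  "(\<lambda>v. z ^ count_x v * verma u u' 0 v) \<star> (\<lambda>v. u' ^ count_x v * verma z z' 0 v) =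
      verma (z * u) (z' * u') 0"
proof
  fix w
  \<comment> \<open>At level 0 only words with as many \<open>x\<close> as \<open>y\<close> matter,
    and reflection exchanges the two counts.\<close>
  have *: "c ^ count_x (refl_word v) * verma z z' 0 v =
      c ^ count_x v * verma z z' 0 v" for c z z' :: 'c and v
    using verma_weight[of z z' 0 v] weight_Lx[of v] by (cases "verma z z' 0 v = 0") auto
  show "((\<lambda>v. z ^ count_x v * verma u u' 0 v) \<star> (\<lambda>v. u' ^ count_x v * verma z z' 0 v)) w =
      verma (z * u) (z' * u') 0 w"
    using fun_cong[OF star_verma[of u' z z' u], of "refl_word w"]
    unfolding star_refl_word verma_refl_word * .
qed

end

section \<open>The exponential\<close>

text \<open>By \<open>star_order\<close>, parts of degree above \<open>count_x u\<close> contribute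
  nothing at \<open>u\<close>, so the expansion is a finite sum.\<close>

lemma star_expand_left:
  "star Q (\<lambda>v. \<phi> (count_x v) * f v) g u =
     (\<Sum>i\<le>count_x u. \<phi> i * star Q (\<lambda>v. if count_x v = i then f v else 0) g u)"
proof -
  have "star Q (\<lambda>v. \<phi> (count_x v) * f v - (\<Sum>i\<le>count_x u. \<phi> i * (if count_x v =
      i then f v else 0))) g u = 0"
    by (rule star_order[where i = "Suc (count_x u)" and j = 0]) (auto simp: if_distrib cong: if_cong)
  then show ?thesis
    by (simp add: star_diff_left star_sum_left star_scale_left)
qed

lemma star_expand_right:
  "star Q g (\<lambda>v. \<phi> (count_x v) * f v) u =
     (\<Sum>i\<le>count_x u. \<phi> i * star Q g (\<lambda>v. if count_x v = i then f v else 0) u)"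
proof -
  have "star Q g (\<lambda>v. \<phi> (count_x v) * f v - (\<Sum>i\<le>count_x u. \<phi> i * (if count_x v =
      i then f v else 0))) u = 0"
    by (rule star_order[where i = 0 and j = "Suc (count_x u)"]) (auto simp: if_distrib cong: if_cong)
  then show ?thesis
    by (simp add: star_diff_right star_sum_right star_scale_right)
qed

text \<open>Both sides are polynomials in \<open>c\<close> at every word, so the graded parts of \<open>f\<close> commute with \<open>g\<close>.\<close>

lemma star_commute_graded:
  fixes f g :: "word \<Rightarrow> 'a::idom"
  assumes "infinite C"
    and "\<And>c. c \<in> C \<Longrightarrow> star Q (\<lambda>v. c ^ count_x v * f v) g = star Q g (\<lambda>v. c ^ count_x v * f v)"
  shows "star Q (\<lambda>v. \<phi> (count_x v) * f v) g = star Q g (\<lambda>v. \<phi> (count_x v) * f v)"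
proof
  fix u
  define d where "d i = star Q (\<lambda>v. if count_x v = i then f v else 0) g u -
      star Q g (\<lambda>v. if count_x v = i then f v else 0) u" for i
  define p where "p = (\<Sum>i\<le>count_x u. monom (d i) i)"
  have "poly p c = 0" if "c \<in> C" for c
    using fun_cong[OF assms(2)[OF that], of u]
    unfolding star_expand_left[where \<phi> = "\<lambda>n. c ^ n"] star_expand_right[where \<phi> = "\<lambda>n. c ^ n"]
    by (simp add: p_def poly_sum poly_monom d_def right_diff_distrib sum_subtractf mult.commute)
  then have "infinite {c. poly p c = 0}"
    by (intro infinite_super[OF _ assms(1)]) auto
  then have "p = 0"
    using poly_roots_finite by blast
  have "d i = 0" if "i \<le> count_x u" for i
  proof -
    have "coeff p i = d i"
      using that by (simp add: p_def coeff_sum)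
    with \<open>p = 0\<close> show ?thesis by simp
  qed
  then show "star Q (\<lambda>v. \<phi> (count_x v) * f v) g u = star Q g (\<lambda>v. \<phi> (count_x v) * f v) u"
    unfolding star_expand_left star_expand_right by (simp add: d_def)
qed

fun star_power :: "(int \<Rightarrow> 'c::comm_ring_1) \<Rightarrow> (word \<Rightarrow> 'c) \<Rightarrow> nat \<Rightarrow> word \<Rightarrow> 'c" where
  "star_power Q f 0 = star_unit"
| "star_power Q f (Suc n) = star Q f (star_power Q f n)"

lemma star_power_order:
  assumes "\<And>u. count_x u = 0 \<Longrightarrow> f u = 0" and "count_x u < n"
  shows "star_power Q f n u = 0"
  using assms(2)
proof (induction n arbitrary: u)
  case (Suc n)
  show ?case
    unfolding star_power.simps
    by (rule star_order[where i = 1 and j = n]) (use Suc assms(1) in auto)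
qed simp

text \<open>Since \<open>f\<close> commutes with its derivative, the differentiated factor can be
  moved to the front in each term of the Leibniz rule.\<close>

lemma (in qshuffle_alg) star_power_derivation:
  assumes "f \<star> (\<lambda>u. of_nat (count_x u) * f u) = (\<lambda>u. of_nat (count_x u) * f u) \<star> f"
  shows "of_nat (count_x u) * star_power Q f (Suc n) u =
    of_nat (Suc n) * ((\<lambda>u. of_nat (count_x u) * f u) \<star> star_power Q f n) u"
proof (induction n arbitrary: u)
  case 0
  show ?case by simp
next
  case (Suc n)
  let ?D = "\<lambda>u. of_nat (count_x u) * f u"
  have IH: "(\<lambda>u. of_nat (count_x u) * star_power Q f (Suc n) u) =
      (\<lambda>u. of_nat (Suc n) * (?D \<star> star_power Q f n) u)"
    using Suc by blast
  have "of_nat (count_x u) * star_power Q f (Suc (Suc n)) u =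
     (?D \<star> star_power Q f (Suc n)) u + (f \<star> (\<lambda>u. of_nat (count_x u) * star_power Q f (Suc n) u)) u"
    by (subst star_power.simps) (rule star_derivation[symmetric])
  also have "\<dots> = (?D \<star> star_power Q f (Suc n)) u + of_nat (Suc n) * ((f \<star> ?D) \<star> star_power Q f n) u"
    unfolding IH star_scale_right star_assoc ..
  also have "\<dots> = of_nat (Suc (Suc n)) * (?D \<star> star_power Q f (Suc n)) u"
    unfolding assms star_assoc by (simp add: algebra_simps)
  finally show ?case .
qed

text \<open>If \<open>f\<close> has no constant term, the higher powers vanish at \<open>u\<close>
  by \<open>star_power_order\<close>.\<close>

definition star_exp :: "(int \<Rightarrow> 'a::field_char_0) \<Rightarrow> (word \<Rightarrow> 'a) \<Rightarrow> word \<Rightarrow> 'a" where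
  "star_exp Q f u = (\<Sum>k\<le>count_x u. star_power Q f k u / fact k)"

text \<open>
  Multiplication by \<open>count_x\<close> corresponds to \<open>t d/dt\<close>, so \<open>ode\<close> says \<open>t g' = t f' \<star> g\<close>.
\<close>

lemma star_exp_unique:
  fixes Q :: "int \<Rightarrow> 'a::field_char_0"
  assumes "qshuffle_alg Q"
    and f0: "\<And>u. count_x u = 0 \<Longrightarrow> f u = 0"
    and comm: "star Q f (\<lambda>u. of_nat (count_x u) * f u) = star Q (\<lambda>u. of_nat (count_x u) * f u) f"
    and ode: "\<And>u. of_nat (count_x u) * g u = star Q (\<lambda>u. of_nat (count_x u) * f u) g u"
    and g0: "\<And>u. count_x u = 0 \<Longrightarrow> g u = star_unit u"
  shows "g = star_exp Q f"
proof
  interpret qshuffle_alg Q by fact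
  let ?D = "\<lambda>u. of_nat (count_x u) * f u"
  show "g u = star_exp Q f u" for u
  proof (induction "count_x u" arbitrary: u rule: less_induct)
    case less
    show ?case
    proof (cases "count_x u = 0")
      case True
      then show ?thesis by (simp add: star_exp_def g0)
    next
      case False
      \<comment> \<open>This partial sum agrees with \<open>g\<close> on all words with fewer
        letters \<open>x\<close> than \<open>u\<close>. As \<open>?D\<close> has no constant term,
        only those values enter the product at \<open>u\<close>.\<close>
      define T where "T v = (\<Sum>k<count_x u. (1 / fact k) * star_power Q f k v)" for v
      have "T v = g v" if "count_x v < count_x u" for v
      proof -
        have "T v = (\<Sum>k\<le>count_x v. (1 / fact k) * star_power Q f k v)"
          unfolding T_def using that
          by (intro sum.mono_neutral_right) (auto simp: star_power_order f0)
        then show ?thesis using less that by (simp add: star_exp_def)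
      qed
      then have "star Q ?D (\<lambda>v. g v - T v) u = 0"
        by (intro star_order[where i = 1 and j = "count_x u"]) auto
      then have "of_nat (count_x u) * g u = star Q ?D T u"
        by (simp add: ode star_diff_right)
      also have "\<dots> = (\<Sum>k<count_x u. (1 / fact k) * star Q ?D (star_power Q f k) u)"
        unfolding T_def star_sum_right star_scale_right ..
      also have "\<dots> = (\<Sum>k<count_x u. of_nat (count_x u) * (star_power Q f (Suc k) u / fact (Suc k)))"
      proof (intro sum.cong refl)
        fix k
        have "of_nat (count_x u) * (star_power Q f (Suc k) u / fact (Suc k)) =
            of_nat (Suc k) * star Q ?D (star_power Q f k) u / fact (Suc k)"
          using star_power_derivation[OF comm, of u k] by (simp only: times_divide_eq_right)
        also have "\<dots> = (1 / fact k) * star Q ?D (star_power Q f k) u"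
          by (simp add: divide_simps del: of_nat_Suc)
        finally show "(1 / fact k) * star Q ?D (star_power Q f k) u =
          of_nat (count_x u) * (star_power Q f (Suc k) u / fact (Suc k))" ..
      qed
      also have "\<dots> = of_nat (count_x u) * (\<Sum>k<count_x u. star_power Q f (Suc k) u / fact (Suc k))"
        by (simp only: sum_distrib_left)
      also have "(\<Sum>k<count_x u. star_power Q f (Suc k) u / fact (Suc k)) = star_exp Q f u"
      proof -
        \<comment> \<open>The index shift leaves out the power 0, which vanishes at
          \<open>u\<close>.\<close>
        have "star_unit u = (0 :: 'a)" using False by (cases u) (auto simp: star_unit_def)
        then show ?thesis
          by (simp add: star_exp_def lessThan_Suc_atMost[symmetric] sum.lessThan_Suc_shift
                   del: sum.lessThan_Suc star_power.simps(2))
      qed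
      finally show ?thesis using False by simp
    qed
  qed
qed

section \<open>Variation of the parameter and the exponential formula\<close>

locale qparam =
  fixes q :: "'a::field_char_0"
  assumes q_nonzero: "q \<noteq> 0" and q_not_root: "\<And>k::nat. k > 0 \<Longrightarrow> q ^ k \<noteq> 1"
begin

abbreviation Q where "Q \<equiv> \<lambda>k. q powi k"
abbreviation \<kappa> where "\<kappa> \<equiv> inverse (q - inverse q)"

sublocale F: qshuffle_bracket Q \<kappa>
  by standard (simp_all add: power_int_add q_nonzero)

text \<open>Over power series the parameter of \<open>verma\<close> can vary infinitesimally while q
  stays constant.\<close>

sublocale E: qshuffle_bracket "\<lambda>k. fps_const (Q k)" "fps_const \<kappa>"
  by standard (simp_all add: power_int_add q_nonzero)

definition S :: "'a \<Rightarrow> word \<Rightarrow> 'a" where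
  "S z = F.verma z (inverse z) 0"

lemma q_sub_inverse: "q - inverse q \<noteq> 0"
proof
  assume "q - inverse q = 0"
  then have "q ^ 2 = 1" using q_nonzero by (simp add: field_simps power2_eq_square)
  then show False using q_not_root[of 2] by simp
qed

lemma qi_1 [simp]: "F.qi 1 = 1"
  using q_sub_inverse by (simp add: F.bracket_def power_int_minus)

text \<open>The step down to level 0 has weight [1] [1; 0] = 0, so no nonempty path ends
  there.\<close>

lemma verma_1: "F.verma 1 1 h u = (if h = 0 \<and> u = [] then 1 else 0)"
proof (induction u arbitrary: h)
  case (Cons a u)
  show ?case
  proof (cases a)
    case Ly
    consider "h = 0" | "h = 1" | "h \<ge> 2" by linarith
    then show ?thesis by cases (auto simp: Ly Cons.IH)
  qed (simp add: Cons.IH)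
qed simp

lemma S_1: "S 1 = star_unit"
  by (auto simp: fun_eq_iff S_def verma_1 star_unit_def)

lemma S_count_x_0: "count_x u = 0 \<Longrightarrow> S z u = star_unit u"
proof (cases u)
  case (Cons a v)
  then show "count_x u = 0 \<Longrightarrow> S z u = star_unit u"
    by (cases a) (simp_all add: S_def star_unit_def)
qed (simp add: star_unit_def S_def)

lemma fps_nth_0_verma:
  "fps_nth (E.verma z z' h u) 0 = F.verma (fps_nth z 0) (fps_nth z' 0) h u"
proof (induction u arbitrary: h)
  case (Cons a u)
  then show ?case
    by (cases a) (simp_all add: E.bracket_def F.bracket_def)
qed simp

lemma verma_fps_const: "E.verma (fps_const z) (fps_const z') h u = fps_const (F.verma z z' h u)"
proof (induction u arbitrary: h)
  case (Cons a u)
  then show ?case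
    by (cases a) (simp_all add: E.bracket_def F.bracket_def flip: fps_const_1_eq_1)
qed simp

text \<open>
  \<open>1 + \<epsilon>\<close> in the ring of power series in \<open>\<epsilon>\<close>; derivatives in the parameter are coefficients of
  \<open>\<epsilon>\<close>.
\<close>

definition eps :: "'a fps" where "eps = 1 + fps_X"

lemma eps_nth [simp]:
  "fps_nth eps 0 = 1" "fps_nth eps (Suc 0) = 1"
  "fps_nth (inverse eps) 0 = 1" "fps_nth (inverse eps) (Suc 0) = - 1"
proof -
  show 0: "fps_nth eps 0 = 1" and 1: "fps_nth eps (Suc 0) = 1"
    by (simp_all add: eps_def)
  then have "eps * inverse eps = 1"
    by (intro inverse_mult_eq_1') simp
  from arg_cong[OF this, of "\<lambda>F. fps_nth F 0"] arg_cong[OF this, of "\<lambda>F. fps_nth F (Suc 0)"]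
  show "fps_nth (inverse eps) 0 = 1" "fps_nth (inverse eps) (Suc 0) = - 1"
    by (simp_all add: fps_mult_nth 0 1 add_eq_0_iff2)
qed

lemma eps_power_nth [simp]:
  "fps_nth (eps ^ n) 0 = 1" "fps_nth (eps ^ n) (Suc 0) = of_nat n"
  "fps_nth (inverse eps ^ n) 0 = 1" "fps_nth (inverse eps ^ n) (Suc 0) = - of_nat n"
  by (induction n) (simp_all add: fps_mult_nth)

definition Xi :: "word \<Rightarrow> 'a" where
  "Xi u = fps_nth (E.verma eps (inverse eps) 0 u) 1"

text \<open>This is z d/dz of \<open>S z\<close>.\<close>

definition Sdot :: "'a \<Rightarrow> word \<Rightarrow> 'a" where
  "Sdot z u = fps_nth (E.verma (fps_const z * eps) (fps_const (inverse z) * inverse eps) 0 u) 1"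

lemma fps_nth_0_verma_eps: "fps_nth (E.verma eps (inverse eps) 0 u) 0 = star_unit u"
  by (simp add: fps_nth_0_verma verma_1 star_unit_def)

lemma power_count_x_star_unit: "(\<lambda>u. c ^ count_x u * star_unit u) = (star_unit :: word \<Rightarrow> 'a)"
  by (auto simp: star_unit_def)

lemmas eps_expand = fps_nth_star Sdot_def S_def Xi_def verma_fps_const
  fps_nth_0_verma_eps power_count_x_star_unit

text \<open>This lemma and the next two compare coefficients of \<epsilon> in the product formulas
  with one parameter 1 + \<epsilon>; the \<open>count_x\<close> term is the derivative of a
  dilation. The first and third give commutation, the second and third the differential
  equation.\<close>

lemma derivative_right:
  "star Q (S z) (\<lambda>v. z ^ count_x v * Xi v) u - of_nat (count_x u) * S z u = Sdot z u"
  using arg_cong[OF fun_cong[OF E.star_verma[where z = "fps_const z" and z' = "fps_const (inverse z)"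
      and u = eps and u' = "inverse eps"], of u], of "\<lambda>F. fps_nth F 1"]
  by (simp add: eps_expand)

lemma derivative_left:
  "star Q (\<lambda>v. inverse z ^ count_x v * Xi v) (S z) u + of_nat (count_x u) * S z u = Sdot z u"
  using arg_cong[OF fun_cong[OF E.star_verma[where u = "fps_const z" and u' = "fps_const (inverse z)"
      and z = eps and z' = "inverse eps"], of u], of "\<lambda>F. fps_nth F 1"]
  by (simp add: eps_expand mult.commute[of eps] mult.commute[of "inverse eps"] add.commute)

lemma derivative_left_swap:
  "star Q (\<lambda>v. z ^ count_x v * Xi v) (S z) u - of_nat (count_x u) * S z u = Sdot z u"
  using arg_cong[OF fun_cong[OF E.star_verma_swap[where z = "fps_const z" and z' = "fps_const (inverse z)"
      and u = eps and u' = "inverse eps"], of u], of "\<lambda>F. fps_nth F 1"]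
  by (simp add: eps_expand)

lemma Xi_commute_same: "star Q (\<lambda>v. z ^ count_x v * Xi v) (S z) =
    star Q (S z) (\<lambda>v. z ^ count_x v * Xi v)"
  using derivative_right[of z] derivative_left_swap[of z] by (simp add: fun_eq_iff diff_eq_eq)

lemma S_mult:
  assumes "z \<noteq> 0" "w \<noteq> 0"
  shows "star Q (\<lambda>v. inverse w ^ count_x v * S z v) (\<lambda>v. z ^ count_x v * S w v) = S (z * w)"
  using F.star_verma[of "inverse w" z "inverse z" w] by (simp add: S_def)

lemma S_mult_swap:
  assumes "z \<noteq> 0" "w \<noteq> 0"
  shows "star Q (\<lambda>v. z ^ count_x v * S w v) (\<lambda>v. inverse w ^ count_x v * S z v) = S (z * w)"
  using F.star_verma_swap[of z w "inverse w" "inverse z"] by (simp add: S_def)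

text \<open>For \<open>w = inverse z\<close> both factors of \<open>S_mult\<close> are dilated by
  \<open>z\<close> and the product is \<open>S 1\<close>; a further dilation by
  \<open>c * inverse z\<close> replaces \<open>z\<close> by \<open>c\<close>.\<close>

lemma S_dilated_inverse:
  assumes "z \<noteq> 0"
  shows "star Q (\<lambda>v. c ^ count_x v * S z v) (\<lambda>v. c ^ count_x v * S (inverse z) v) = star_unit"
proof -
  define f where "f = (\<lambda>w v. z ^ count_x v * S w v)"
  have "star Q (f z) (f (inverse z)) = star_unit"
    using S_mult[of z "inverse z"] assms by (simp add: S_1 f_def)
  then have "star Q (\<lambda>v. (c * inverse z) ^ count_x v * f z v)
     (\<lambda>v. (c * inverse z) ^ count_x v * f (inverse z) v) = star_unit"
    by (simp add: fun_eq_iff star_dilate) (simp add: star_unit_def)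
  then show ?thesis
    using assms by (simp add: f_def mult.assoc[symmetric] flip: power_mult_distrib) (simp add: mult.assoc)
qed

lemma star_S_cancel_right:
  assumes "z \<noteq> 0" and "star Q f (\<lambda>v. c ^ count_x v * S z v) = star Q g (\<lambda>v. c ^ count_x v * S z v)"
  shows "f = g"
proof -
  have "star Q (star Q f (\<lambda>v. c ^ count_x v * S z v)) (\<lambda>v. c ^ count_x v * S (inverse z) v) =
        star Q (star Q g (\<lambda>v. c ^ count_x v * S z v)) (\<lambda>v. c ^ count_x v * S (inverse z) v)"
    by (simp only: assms(2))
  then show ?thesis
    by (simp add: F.star_assoc S_dilated_inverse[OF assms(1)])
qed

lemma dilate_commute:
  assumes "star Q f g = star Q g f"
  shows "star Q (\<lambda>v. c ^ count_x v * f v) (\<lambda>v. c ^ count_x v * g v) =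
         star Q (\<lambda>v. c ^ count_x v * g v) (\<lambda>v. c ^ count_x v * f v)"
  using assms by (simp add: fun_eq_iff star_dilate)

text \<open>
  Both \<open>S (z * w)\<close> and the dilated \<open>S w\<close> commute with \<open>Xi\<close> dilated by \<open>z * w\<close>; hence so does the
  remaining factor of \<open>S (z * w)\<close>.
\<close>

lemma Xi_commute_square:
  assumes "z \<noteq> 0" "w \<noteq> 0"
  shows "star Q (\<lambda>v. (z * w ^ 2) ^ count_x v * Xi v) (S z) =
      star Q (S z) (\<lambda>v. (z * w ^ 2) ^ count_x v * Xi v)"
proof -
  define f where "f = (\<lambda>v. (z * w) ^ count_x v * Xi v)"
  define A where "A = (\<lambda>v. inverse w ^ count_x v * S z v)"
  define B where "B = (\<lambda>v. z ^ count_x v * S w v)"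
  have AB: "star Q A B = S (z * w)" unfolding A_def B_def by (rule S_mult[OF assms])
  have fB: "star Q f B = star Q B f"
    using dilate_commute[OF Xi_commute_same[of w], of z]
    by (simp add: f_def B_def power_mult_distrib mult.assoc)
  have "star Q (star Q f A) B = star Q (star Q A B) f"
    using Xi_commute_same[of "z * w"] by (simp add: AB F.star_assoc f_def)
  also have "\<dots> = star Q (star Q A f) B"
    by (simp add: F.star_assoc fB)
  finally have "star Q f A = star Q A f"
    unfolding B_def by (rule star_S_cancel_right[OF assms(2)])
  from dilate_commute[OF this, of w] show ?thesis
    using assms by (simp add: f_def A_def power_mult_distrib[symmetric] mult.assoc[symmetric]
      power2_eq_square mult.commute[of w z] mult.left_commute)
qed

text \<open>The powers are distinct as q is not a root of unity. They are the dilations of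
  \<open>Xi\<close> to which \<open>star_commute_graded\<close> is applied.\<close>

lemma infinite_q_powers:
  assumes "c \<noteq> 0"
  shows "infinite (range (\<lambda>k::nat. c * (q ^ k) ^ 2))"
proof (rule range_inj_infinite, rule linorder_injI)
  fix i j :: nat
  assume "i < j"
  show "c * (q ^ i) ^ 2 \<noteq> c * (q ^ j) ^ 2"
  proof
    assume "c * (q ^ i) ^ 2 = c * (q ^ j) ^ 2"
    then have "q ^ (2 * i) = q ^ (2 * j)"
      using assms by (simp add: mult.commute flip: power_mult)
    also have "2 * j = 2 * i + 2 * (j - i)" using \<open>i < j\<close> by simp
    finally have "q ^ (2 * i) * q ^ (2 * (j - i)) = q ^ (2 * i)"
      by (simp only: power_add)
    then have "q ^ (2 * (j - i)) = 1" using q_nonzero by simp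
    then show False using q_not_root[of "2 * (j - i)"] \<open>i < j\<close> by simp
  qed
qed

lemma Xi_commute:
  assumes "z \<noteq> 0"
  shows "star Q (\<lambda>v. \<phi> (count_x v) * Xi v) (S z) = star Q (S z) (\<lambda>v. \<phi> (count_x v) * Xi v)"
  by (rule star_commute_graded[OF infinite_q_powers[OF assms]])
     (use Xi_commute_square[OF assms] q_nonzero in auto)

text \<open>The solution without constant term of 2 t L'(t) = X(z t) - X(z^-1 t).\<close>

definition logS :: "'a \<Rightarrow> word \<Rightarrow> 'a" where
  "logS z v = (z ^ count_x v - inverse z ^ count_x v) / of_nat (2 * count_x v) * Xi v"

theorem S_eq_exp:
  assumes "z \<noteq> 0"
  shows "S z = star_exp Q (logS z)"
proof (rule star_exp_unique)
  let ?L = "logS z"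
  let ?D = "\<lambda>u. of_nat (count_x u) * logS z u"
  have D: "?D = (\<lambda>v. ((z ^ count_x v - inverse z ^ count_x v) / 2) * Xi v)"
    by (auto simp: fun_eq_iff logS_def)
  have LS: "star Q ?L (S z) = star Q (S z) ?L"
    using Xi_commute[OF assms, of "\<lambda>n. (z ^ n - inverse z ^ n) / of_nat (2 * n)"]
    unfolding logS_def .
  have DS: "star Q ?D (S z) = star Q (S z) ?D"
    using Xi_commute[OF assms, of "\<lambda>n. (z ^ n - inverse z ^ n) / 2"] unfolding D .
  show ode: "of_nat (count_x u) * S z u = star Q ?D (S z) u" for u
  proof -
    have *: "?D = (\<lambda>v. (1 / 2) * (z ^ count_x v * Xi v - inverse z ^ count_x v * Xi v))"
      unfolding D by (simp add: fun_eq_iff left_diff_distrib)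
    \<comment> \<open>Subtracting \<open>derivative_left\<close> from
      \<open>derivative_left_swap\<close> eliminates \<open>Sdot\<close>.\<close>
    show ?thesis
      unfolding * star_scale_left star_diff_left
      using derivative_left[of z u, symmetric] derivative_left_swap[of z u]
      by (simp add: diff_eq_eq)
  qed
  \<comment> \<open>Applying t d/dt to the commutation of \<open>?L\<close> with \<open>S z\<close>
    and inserting \<open>ode\<close> gives the claim multiplied on the right by \<open>S z\<close>,
    which is cancelled.\<close>
  show "star Q ?L ?D = star Q ?D ?L"
  proof -
    let ?DS = "\<lambda>u. of_nat (count_x u) * S z u"
    have o: "?DS = star Q ?D (S z)" using ode by blast
    have "star Q ?L ?DS = star Q ?DS ?L"
    proof
      fix w
      have "star Q ?D (S z) w + star Q ?L ?DS w = star Q ?DS ?L w + star Q (S z) ?D w"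
        unfolding star_derivation LS ..
      then show "star Q ?L ?DS w = star Q ?DS ?L w" by (simp add: DS)
    qed
    then have "star Q (star Q ?L ?D) (S z) = star Q (star Q ?D ?L) (S z)"
      unfolding o F.star_assoc LS .
    then show ?thesis using star_S_cancel_right[OF assms, of _ 1] by simp
  qed
qed (auto simp: logS_def S_count_x_0 intro: F.qshuffle_alg_axioms)

end

section \<open>Transfer to power series\<close>

abbreviation lookup :: "('b \<Rightarrow>\<^sub>0 'c::zero) \<Rightarrow> 'b \<Rightarrow> 'c" where
  "lookup \<equiv> Poly_Mapping.lookup"

lemma lookup_of_word: "lookup (of_word u) w = (if w = u then 1 else 0)"
  by (simp add: of_word_def lookup_single when_def)

lemma free_alg_induct [case_names single add]:
  assumes "\<And>u c. P (Poly_Mapping.single u c)" and "\<And>f g. P f \<Longrightarrow> P g \<Longrightarrow> P (f + g)"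
  shows "P (p :: 'b \<Rightarrow>\<^sub>0 'c::comm_monoid_add)"
proof -
  have "P (\<Sum>u\<in>A. Poly_Mapping.single u (lookup p u))" for A
  proof (induction A rule: infinite_finite_induct)
    case (insert u A)
    then show ?case by (simp add: assms)
  \<comment> \<open>The sum over an empty or infinite set is 0, which is
    \<open>single undefined 0\<close>.\<close>
  qed (use assms(1)[of undefined 0] in simp_all)
  moreover have "(\<Sum>u\<in>Poly_Mapping.keys p. Poly_Mapping.single u (lookup p u)) = p"
    by (rule poly_mapping_eqI) (simp add: lookup_sum lookup_single when_def in_keys_iff)
  ultimately show ?thesis by metis
qed

lemma lookup_of_word_mult:
  fixes p :: "'a::field free_alg"
  shows "lookup (of_word [a] * p) w =
    (case w of [] \<Rightarrow> 0 | b # w' \<Rightarrow> if b = a then lookup p w' else 0)"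
  by (induction p rule: free_alg_induct)
     (auto simp: of_word_def mult_single lookup_single when_def plus_list_def distrib_left lookup_add
       split: list.split)

lemma lookup_mult_of_word:
  fixes p :: "'a::field free_alg"
  shows "lookup (p * of_word [a]) w = (if w \<noteq> [] \<and> last w = a then lookup p (butlast w) else 0)"
  by (induction p rule: free_alg_induct; cases w rule: rev_cases)
     (auto simp: of_word_def mult_single lookup_single when_def plus_list_def distrib_right lookup_add)

lemma qshuffle_alg_powi: "q \<noteq> 0 \<Longrightarrow> qshuffle_alg (\<lambda>k. q powi k)" for q :: "'a::field"
  by standard (simp_all add: power_int_add)

text \<open>\<open>qshuffle_word\<close> recurses on the factors, \<open>star\<close> on the
  argument. They agree because the first letter of \<open>w\<close> comes from one of the factors,
  and on an indicator function the twist is a scalar.\<close>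

lemma lookup_qshuffle_word:
  fixes q :: "'a::field"
  assumes "q \<noteq> 0"
  shows "lookup (qshuffle_word q u v) w =
     star (\<lambda>k. q powi k) (\<lambda>w. if w = u then 1 else 0) (\<lambda>w. if w = v then 1 else 0) w"
proof -
  have unit: "(\<lambda>w. if w = [] then 1 else 0 :: 'a) = star_unit"
    by (simp add: star_unit_def fun_eq_iff)
  have ite: "(\<lambda>v. if P \<and> v = u then 1 else 0 :: 'a) = (if P then (\<lambda>v. if v =
      u then 1 else 0) else (\<lambda>_. 0))"
    for P and u :: word by auto
  show ?thesis
    using assms
  proof (induction q u v arbitrary: w rule: qshuffle_word.induct)
    case (1 q v)
    then interpret qshuffle_alg "\<lambda>k. q powi k" by (rule qshuffle_alg_powi)
    show ?case by (simp add: unit lookup_of_word)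
  next
    case (2 q a u)
    then interpret qshuffle_alg "\<lambda>k. q powi k" by (rule qshuffle_alg_powi)
    show ?case by (simp add: unit lookup_of_word del: star.simps)
  next
    case (3 q a u b v)
    have tw: "(\<lambda>v. q powi letter_weight c v * (if v = u then 1 else 0)) =
        (\<lambda>v. q powi letter_weight c u * (if v = u then 1 else 0))"
      for c u by auto
    show ?case
    proof (cases w)
      case (Cons c w')
      have "(\<Sum>d\<leftarrow>a # u. pairing b d) = letter_weight b (a # u)" by (simp only: letter_weight_def)
      with Cons 3 show ?thesis
        by (auto simp: lookup_add lookup_of_word_mult ite tw star_scale_left
          simp del: weight_simps(2) sum_list.Cons pairing.simps)
    qed (simp add: lookup_add lookup_of_word_mult)
  qed
qed

lemma lookup_qshuffle:
  fixes f g :: "'a::field free_alg"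
  assumes "q \<noteq> 0"
  shows "lookup (qshuffle q f g) w = star (\<lambda>k. q powi k) (lookup f) (lookup g) w"
proof -
  have expand: "lookup f = (\<lambda>w. \<Sum>u\<in>Poly_Mapping.keys f. lookup f u * (if w =
      u then 1 else 0))" for f :: "'a free_alg"
  proof
    fix w
    show "lookup f w = (\<Sum>u\<in>Poly_Mapping.keys f. lookup f u * (if w = u then 1 else 0))"
      by (simp add: if_distrib in_keys_iff cong: if_cong)
  qed
  show ?thesis
    by (subst (2) expand, subst (3) expand)
       (simp add: qshuffle_def lookup_sum lookup_qshuffle_word[OF assms] star_sum_left star_sum_right
          star_scale_left star_scale_right mult.assoc)
qed

definition represents :: "'a::field free_alg fps \<Rightarrow> (word \<Rightarrow> 'a) \<Rightarrow> bool" where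
  "represents F f \<longleftrightarrow> (\<forall>n w. lookup (fps_nth F n) w = (if count_x w = n then f w else 0))"

lemma represents_unique: "represents F f \<Longrightarrow> represents G f \<Longrightarrow> F = G"
  by (auto simp: represents_def fps_eq_iff poly_mapping_eq_iff fun_eq_iff)

lemma lookup_1: "lookup (1 :: 'a::field free_alg) w = (if w = [] then 1 else 0)"
  by (simp flip: of_word_Nil add: lookup_of_word)

lemma represents_1: "represents 1 star_unit"
  by (auto simp: represents_def lookup_1 star_unit_def)

lemma represents_mult:
  fixes F G :: "'a::field free_alg fps"
  assumes "q \<noteq> 0" "represents F f" "represents G g"
  shows "represents (fps_qshuffle q F G) (star (\<lambda>k. q powi k) f g)"
proof -
  have *: "lookup (fps_nth F i) = (\<lambda>w. if count_x w = i then f w else 0)"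
    "lookup (fps_nth G i) = (\<lambda>w. if count_x w = i then g w else 0)" for i
    using assms(2,3) by (auto simp: represents_def)
  show ?thesis
    unfolding represents_def fps_qshuffle_def
    by (simp add: lookup_sum lookup_qshuffle[OF assms(1)] * star_graded)
qed

lemma represents_dilate:
  "represents F f \<Longrightarrow> represents (fps_dilate c F) (\<lambda>w. c ^ count_x w * f w)"
  by (simp add: represents_def fps_dilate_def)

lemma represents_uminus: "represents F f \<Longrightarrow> represents (- F) (\<lambda>w. - f w)"
  by (simp add: represents_def)

lemma represents_exp:
  fixes F :: "'a::field_char_0 free_alg fps"
  assumes "q \<noteq> 0" "represents F f" "\<And>w. count_x w = 0 \<Longrightarrow> f w = 0"
  shows "represents (fps_qshuffle_exp q F) (star_exp (\<lambda>k. q powi k) f)"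
proof -
  have "represents (fps_qshuffle_power q F k) (star_power (\<lambda>k. q powi k) f k)" for k
    by (induction k)
       (use assms in \<open>simp_all add: fps_qshuffle_power_0 fps_qshuffle_power_Suc represents_1 represents_mult\<close>)
  then have *: "lookup (fps_nth (fps_qshuffle_power q F k) n) w =
      (if count_x w = n then star_power (\<lambda>k. q powi k) f k w else 0)" for k n w
    by (simp add: represents_def)
  have "fps_nth F 0 = 0"
    using assms(2,3) by (intro poly_mapping_eqI) (auto simp: represents_def)
  note exp = fps_qshuffle_exp_sums(2)[OF this]
  show ?thesis
    by (simp add: represents_def exp lookup_sum * star_exp_def)
qed

text \<open>Uniqueness is needed among all series: as \<open>F\<close> has constant term 1, its
  product with \<open>H\<close> determines the coefficients of \<open>H\<close> recursively.\<close>

lemma fps_qshuffle_inverse_eq: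
  fixes F G :: "'a::field free_alg fps"
  assumes "q \<noteq> 0" "fps_nth F 0 = 1" "fps_qshuffle q F G = 1" "fps_qshuffle q G F = 1"
  shows "fps_qshuffle_inverse q F = G"
  unfolding fps_qshuffle_inverse_def
proof (rule the_equality)
  interpret qshuffle_alg "\<lambda>k. q powi k"
    using assms(1) by (rule qshuffle_alg_powi)
  have one: "qshuffle q 1 p = p" for p :: "'a free_alg"
  proof (rule poly_mapping_eqI)
    have "lookup (1 :: 'a free_alg) = star_unit"
      by (simp add: fun_eq_iff lookup_1 star_unit_def)
    then show "lookup (qshuffle q 1 p) w = lookup p w" for w
      by (simp add: lookup_qshuffle[OF assms(1)])
  qed
  fix H assume "fps_qshuffle q F H = 1 \<and> fps_qshuffle q H F = 1"
  then have FH: "fps_qshuffle q F H = fps_qshuffle q F G" using assms by simp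
  have "fps_nth H n = fps_nth G n" for n
  proof (induction n rule: less_induct)
    case (less n)
    have nth: "fps_nth (fps_qshuffle q F K) n =
      fps_nth K n + (\<Sum>i\<in>{..n} - {0}. qshuffle q (fps_nth F i) (fps_nth K (n - i)))" for K
      by (simp add: fps_qshuffle_def sum.remove[of "{..n}" 0] assms(2) one)
    have "(\<Sum>i\<in>{..n} - {0}. qshuffle q (fps_nth F i) (fps_nth H (n - i))) =
        (\<Sum>i\<in>{..n} - {0}. qshuffle q (fps_nth F i) (fps_nth G (n - i)))"
      by (intro sum.cong refl) (auto simp: less)
    then show ?case using nth[of H] nth[of G] unfolding FH by simp
  qed
  then show "H = G" by (simp add: fps_eq_iff)
qed (use assms in simp)

section \<open>Catalan words as lattice paths\<close>

lemma height_simps [simp]: "height w 0 = 0" "height (a # w) (Suc i) = bar a + height w i"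
  by (simp_all add: height_def)

lemma height_Suc: "i < length w \<Longrightarrow> height w (Suc i) = height w i + bar (w ! i)"
  by (simp add: height_def take_Suc_conv_app_nth)

lemma height_length: "height w (length w) = 2 * int (count_x w) - int (length w)"
proof (induction w)
  case (Cons a w)
  then show ?case by (cases a) simp_all
qed simp

text \<open>\<open>\<omega>\<close> takes the level that a letter leaves, while down steps of
  \<open>path\<close> are indexed by their lower end; hence the \<open>+ 1\<close>.\<close>

lemma path_eq_prod:
  "path (\<lambda>h. \<omega> (int h) Lx) (\<lambda>h. \<omega> (int h + 1) Ly) h 0 w =
     (if (\<forall>i\<le>length w. 0 \<le> int h + height w i) \<and> int h + height w (length w) = 0
      then \<Prod>i<length w. \<omega> (int h + height w i) (w ! i) else 0)"
proof (induction w arbitrary: h)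
  case (Cons a w)
  have all: "(\<forall>i\<le>length (a # w). 0 \<le> int h + height (a # w) i) \<longleftrightarrow>
      (\<forall>i\<le>length w. 0 \<le> int h + bar a + height w i)" (is "?l \<longleftrightarrow> ?r")
  proof
    show ?r if ?l
    proof (intro allI impI)
      fix i assume "i \<le> length w"
      with that[rule_format, of "Suc i"] show "0 \<le> int h + bar a + height w i" by simp
    qed
    show ?l if ?r
    proof (intro allI impI)
      fix i assume "i \<le> length (a # w)"
      with that[rule_format, of "i - 1"] show "0 \<le> int h + height (a # w) i" by (cases i) auto
    qed
  qed
  have prod: "(\<Prod>i<length (a # w). \<omega> (int h + height (a # w) i) ((a # w) ! i)) =
     \<omega> (int h) a * (\<Prod>i<length w. \<omega> (int h + bar a + height w i) (w ! i))"
    by (simp add: prod.lessThan_Suc_shift add.assoc del: prod.lessThan_Suc)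
  have len: "int h + height (a # w) (length (a # w)) = int h + bar a + height w (length w)"
    by simp
  show ?case
  proof (cases a)
    case Lx
    then have e: "int h + bar a = int (Suc h)" by simp
    show ?thesis
      unfolding all prod len e unfolding Lx path.simps Cons.IH by auto
  next
    case Ly
    show ?thesis
    proof (cases h)
      case 0
      \<comment> \<open>The witness 0 stands for the height after the first letter, here -1.\<close>
      then show ?thesis unfolding all using Ly by (auto intro!: exI[of _ 0])
    next
      case (Suc g)
      then have e: "int h + bar a = int g" using Ly by simp
      show ?thesis
        unfolding all prod len e unfolding Ly Suc path.simps Cons.IH by (auto simp: add.commute)
    qed
  qed
qed simp

lemma catalan_words_iff:
  "w \<in> catalan_words n \<longleftrightarrow>
     (\<forall>i\<le>length w. 0 \<le> height w i) \<and> height w (length w) = 0 \<and> count_x w = n"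
proof -
  have "catalan w \<longleftrightarrow> (\<forall>i\<le>length w. 0 \<le> height w i) \<and> height w (length w) = 0"
  proof
    assume c: "catalan w"
    have "0 \<le> height w i" if "i \<le> length w" for i
      using c that unfolding catalan_def
      by (cases "i = 0"; cases "i = length w") auto
    with c show "(\<forall>i\<le>length w. 0 \<le> height w i) \<and> height w (length w) = 0"
      by (auto simp: catalan_def)
  qed (auto simp: catalan_def)
  then show ?thesis
    using height_length[of w] by (auto simp: catalan_words_def)
qed

lemma lookup_catalan_words_sum:
  "lookup (\<Sum>w\<in>catalan_words n. scale (\<Prod>i<2 * n. \<omega> (height w i) (w ! i)) (of_word w)) u =
     (if count_x u = n then path (\<lambda>h. \<omega> (int h) Lx) (\<lambda>h. \<omega> (int h + 1) Ly) 0 0 u else 0)"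
proof -
  have "lookup (\<Sum>w\<in>catalan_words n. scale (\<Prod>i<2 * n. \<omega> (height w i) (w ! i)) (of_word w)) u =
     (if u \<in> catalan_words n then \<Prod>i<2 * n. \<omega> (height u i) (u ! i) else 0)"
    using finite_catalan_words[of n]
    by (simp add: lookup_sum lookup_of_word if_distrib eq_commute[of u] cong: if_cong)
  also have "\<dots> = (if count_x u = n then path (\<lambda>h. \<omega> (int h) Lx) (\<lambda>h. \<omega> (int h + 1) Ly) 0 0 u else 0)"
  proof (cases "u \<in> catalan_words n")
    case True
    then have "length u = 2 * n" by (simp add: catalan_words_def)
    with True show ?thesis using path_eq_prod[of \<omega> 0 u] by (simp add: catalan_words_iff)
  next
    case False
    then show ?thesis using path_eq_prod[of \<omega> 0 u] by (auto simp: catalan_words_iff)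
  qed
  finally show ?thesis .
qed

lemma lookup_catalan_sum:
  "lookup (catalan_sum q s m n) u =
     (if count_x u = n then path (\<lambda>h. qint q (int h + s * int m)) (\<lambda>h. qint q (int h + 1)) 0 0 u else 0)"
  using lookup_catalan_words_sum[where n = n and u = u and
      \<omega> = "\<lambda>h a. qint q (h + s * (int m * (bar a + 1) div 2))"]
  by (simp add: catalan_sum_def prod.atLeast1_atMost_eq)

text \<open>The weights of \<open>C_elem\<close> use the level reached: h + 1 after a step up from
  h, and h after a step down from h + 1.\<close>

lemma lookup_C_elem:
  "lookup (C_elem q n) u =
     (if count_x u = n then path (\<lambda>h. qint q (int h + 2)) (\<lambda>h. qint q (int h + 1)) 0 0 u else 0)"
proof -
  have "C_elem q n = (\<Sum>w\<in>catalan_words n. scale (\<Prod>i<2 * n. qint q (1 + height w i +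
      bar (w ! i))) (of_word w))"
    unfolding C_elem_def One_nat_def prod.atLeast1_atMost_eq
    by (intro sum.cong refl arg_cong2[where f = scale] prod.cong)
       (auto simp: catalan_words_def height_Suc add.assoc)
  then show ?thesis
    using lookup_catalan_words_sum[where n = n and u = u and \<omega> = "\<lambda>h a. qint q (1 + h + bar a)"]
    by (simp add: add.commute)
qed

section \<open>Identification of the series of the theorem\<close>

context qparam
begin

lemma qint_eq_qi: "qint q n = F.qi n"
  by (simp add: qint_def F.bracket_def divide_inverse mult.commute)

lemma bracket_power: "F.bracket (q powi e) (inverse (q powi e)) h = F.qi (h + e)"
proof -
  have "Q (h + e) = Q e * Q h" by (simp only: F.Q_add mult.commute)
  moreover have "Q (- (h + e)) = inverse (Q e) * Q (- h)"
    by (simp only: power_int_minus F.Q_add inverse_mult_distrib mult.commute)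
  ultimately show ?thesis by (simp only: F.bracket_def mult_1)
qed

lemma S_power_eq_path:
  "S (q powi e) u = path (\<lambda>h. qint q (int h + e)) (\<lambda>h. qint q (int h + 1)) 0 0 u"
  using path_gauge[of "\<lambda>h. qint q (int h + e)" 0 "\<lambda>h. qint q (int h + 1)" u]
  by (simp add: S_def F.verma_def bracket_power qint_eq_qi mult.commute)

lemma represents_catalan_sum: "represents (Abs_fps (catalan_sum q s m)) (S (q powi (s * int m)))"
  by (simp add: represents_def lookup_catalan_sum S_power_eq_path)

text \<open>At order zero the step down to level 0 has weight 0. To first order it therefore occurs
  once, as the last letter, with derivative 2 \<kappa>; the rest of the path stays above level 0 and
  is described one level lower.\<close>

lemma fps_nth_verma_eps_Suc:
  "fps_nth (E.verma eps (inverse eps) (Suc h) v) 1 = 2 * \<kappa> *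
     (if v \<noteq> [] \<and> last v = Ly
      then path (\<lambda>_. 1) (\<lambda>i. F.qi (int i + 2) * F.qi (int i + 1)) h 0 (butlast v) else 0)"
proof (induction v arbitrary: h)
  case (Cons a v)
  show ?case
  proof (cases a)
    case Lx
    then show ?thesis using Cons.IH[of "Suc h"] by simp
  next
    case Ly
    have b0: "fps_nth (E.bracket eps (inverse eps) i) 0 = F.qi i"
      and b1: "fps_nth (E.bracket eps (inverse eps) i) 1 = \<kappa> * (Q i + Q (- i))"
      and qi: "E.qi i = fps_const (F.qi i)" for i
      by (simp_all add: E.bracket_def F.bracket_def flip: fps_const_1_eq_1)
    have *: "fps_nth (E.verma eps (inverse eps) (Suc h) (a # v)) 1 =
      F.qi (int h + 1) * (F.qi (int h) * fps_nth (E.verma eps (inverse eps) h v) 1 +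
        \<kappa> * (Q (int h) + Q (- int h)) * (if h = 0 \<and> v = [] then 1 else 0))"
      using b0 b1 by (simp add: Ly qi fps_mult_nth fps_nth_0_verma verma_1 mult.assoc algebra_simps)
    show ?thesis
    proof (cases h)
      case 0
      then show ?thesis unfolding * using Ly by (cases "butlast v") (auto simp: Ly)
    next
      case (Suc g)
      then show ?thesis unfolding * using Ly Cons.IH[of g]
        by (auto simp: algebra_simps)
    qed
  qed
qed simp

lemma count_x_butlast: "v \<noteq> [] \<Longrightarrow> last v = Ly \<Longrightarrow> count_x (butlast v) = count_x v"
  by (induction v rule: count_x.induct) auto

text \<open>A path that returns to level 0 only at its end is x v y with v Catalan, and
  \<open>path_gauge\<close> identifies the weights of v with those of \<open>C_elem\<close>.\<close>

lemma Xi_eq_xCy: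
  assumes "count_x u = Suc k"
  shows "Xi u = 2 * \<kappa> * lookup (of_word [Lx] * C_elem q k * of_word [Ly]) u"
proof -
  have g: "path (\<lambda>h. qint q (int h + 2)) (\<lambda>h. qint q (int h + 1)) 0 0 w =
      path (\<lambda>_. 1) (\<lambda>i. F.qi (int i + 2) * F.qi (int i + 1)) 0 0 w" for w
    using path_gauge[of "\<lambda>h. qint q (int h + 2)" 0 "\<lambda>h. qint q (int h + 1)" w]
    by (simp add: qint_eq_qi)
  show ?thesis
  proof (cases u)
    case (Cons a v)
    show ?thesis
    proof (cases a)
      case Lx
      then show ?thesis
        using assms fps_nth_verma_eps_Suc[of 0 v] count_x_butlast[of v] unfolding Xi_def
        by (auto simp: Cons lookup_mult_of_word lookup_of_word_mult lookup_C_elem g mult.assoc)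
    next
      case Ly
      then show ?thesis
        by (simp add: Cons Xi_def mult.assoc lookup_of_word_mult)
    qed
  qed (use assms in simp)
qed

lemma logS_inverse: "logS (inverse z) = (\<lambda>v. - logS z v)"
proof
  fix v
  have "inverse z ^ count_x v - z ^ count_x v = - (z ^ count_x v - inverse z ^ count_x v)" by simp
  then show "logS (inverse z) v = - logS z v"
    unfolding logS_def inverse_inverse_eq by (simp only: minus_divide_left[symmetric] mult_minus_left)
qed

text \<open>For z = q^m, [m k] = \<kappa> (z^k - z^-k). The factor 2 \<kappa> of
  \<open>Xi_eq_xCy\<close> supplies this \<kappa> and cancels the 2 in \<open>logS\<close>.\<close>

lemma represents_xCy_series: "represents (xCy_series q m) (logS (q powi int m))"
proof -
  have *: "qint q (int (m * k)) = \<kappa> * ((q powi int m) ^ k - inverse (q powi int m) ^ k)" for k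
    using q_nonzero
    by (simp add: qint_eq_qi F.bracket_def power_int_minus power_inverse power_mult flip: of_nat_mult)
  show ?thesis
    unfolding represents_def
  proof (intro allI)
    fix n w
    show "lookup (fps_nth (xCy_series q m) n) w = (if count_x w = n then logS (q powi int m) w else 0)"
    proof (cases "n = 0")
      case True
      then show ?thesis by (simp add: xCy_series_def logS_def)
    next
      case n: False
      let ?c = "lookup (of_word [Lx] * C_elem q (n - 1) * of_word [Ly]) w"
      have nth: "lookup (fps_nth (xCy_series q m) n) w = qint q (int (m * n)) / of_nat n * ?c"
        using n by (simp add: xCy_series_def)
      show ?thesis
      proof (cases "count_x w = n")
        case True
        then have "Xi w = 2 * \<kappa> * ?c" using Xi_eq_xCy[of w "n - 1"] n by simp
        with True n show ?thesis unfolding nth * by (simp add: logS_def)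
      next
        case False
        have "?c = 0"
        proof (cases w)
          case (Cons a v)
          then show ?thesis using False n count_x_butlast[of v]
            by (cases a) (auto simp: lookup_mult_of_word lookup_of_word_mult lookup_C_elem mult.assoc)
        qed (simp add: lookup_mult_of_word)
        then show ?thesis using False by (simp add: nth)
      qed
    qed
  qed
qed

text \<open>The step down from level 2 has the factor [0], so no path from there returns. Hence
  \<open>S (inverse q)\<close> is supported on the words (xy)^n.\<close>

lemma verma_inverse_q_0: "h \<ge> 2 \<Longrightarrow> F.verma (inverse q) q h w = 0"
proof (induction w arbitrary: h)
  case (Cons a w)
  have b: "F.bracket (inverse q) q i = F.qi (i - 1)" for i
    using bracket_power[of "-1" i] q_nonzero by (simp add: power_int_minus)
  show ?case
    using Cons by (cases a; cases "h = 2") (auto simp: b)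
qed simp

lemma S_inverse_q:
  "S (inverse q) (Lx # Ly # w) = - S (inverse q) w"
  "S (inverse q) (Lx # Lx # w) = 0"
  "S (inverse q) [Lx] = 0"
  "S (inverse q) (Ly # w) = 0"
proof -
  have "F.qi (- 1) = - F.qi 1" by (simp only: F.bracket_def) (simp add: algebra_simps)
  then have "F.bracket (inverse q) q 0 = - 1"
    using bracket_power[of "-1" 0] q_nonzero by (simp add: power_int_minus)
  then show "S (inverse q) (Lx # Ly # w) = - S (inverse q) w"
    by (simp add: S_def)
qed (simp_all add: S_def verma_inverse_q_0)

lemma represents_G_tilde: "represents G_tilde (\<lambda>w. (- 1) ^ count_x w * S (inverse q) w)"
proof -
  have "lookup ((of_word [Lx] * of_word [Ly]) ^ n) w = (if count_x w =
      n then (- 1) ^ count_x w * S (inverse q) w else 0)"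
    for n w
  proof (induction n arbitrary: w)
    case 0
    then show ?case by (auto simp: lookup_1 S_count_x_0 star_unit_def)
  next
    case (Suc n)
    show ?case
    proof (cases w rule: count_x.cases)
      case (2 v)
      then show ?thesis
      proof (cases v rule: count_x.cases)
        case (3 v')
        then show ?thesis using 2
          by (simp add: mult.assoc lookup_of_word_mult Suc S_inverse_q)
      qed (simp_all add: mult.assoc lookup_of_word_mult S_inverse_q)
    qed (simp_all add: mult.assoc lookup_of_word_mult S_inverse_q)
  qed
  then show ?thesis by (simp add: represents_def G_tilde_def)
qed

lemma represents_D_series: "represents (D_series q) (\<lambda>w. (- 1) ^ count_x w * S q w)"
proof -
  let ?G = "fps_dilate (-1) (Abs_fps (catalan_sum q 1 1))"
  have G: "represents ?G (\<lambda>w. (- 1) ^ count_x w * S q w)"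
    using represents_dilate[OF represents_catalan_sum[of 1 1], of "-1"] by simp
  have "fps_qshuffle q G_tilde ?G = 1"
    using represents_mult[OF q_nonzero represents_G_tilde G] S_dilated_inverse[of "inverse q" "-1"] q_nonzero
    by (auto intro: represents_unique represents_1)
  moreover have "fps_qshuffle q ?G G_tilde = 1"
    using represents_mult[OF q_nonzero G represents_G_tilde] S_dilated_inverse[of q "-1"] q_nonzero
    by (auto intro: represents_unique represents_1)
  ultimately have "D_series q = ?G"
    unfolding D_series_def by (intro fps_qshuffle_inverse_eq q_nonzero) (simp_all add: G_tilde_def)
  with G show ?thesis by simp
qed

lemma represents_dilated_product:
  assumes F: "represents F (\<lambda>w. (- 1) ^ count_x w * S (q powi e) w)" and e: "e = 1 \<or> e = - 1"
  shows "represents (dilated_product q m F) (S (q powi (e * int m)))"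
proof -
  \<comment> \<open>The dilation by \<open>c\<close> serves the induction: without its first factor,
    the product is the one with a factor less, dilated by q^-1.\<close>
  have "represents (foldr (fps_qshuffle q)
      (map (\<lambda>j. fps_dilate (- (c * q powi (int m - 1 - 2 * int j))) F) [0..<m]) 1)
      (\<lambda>w. c ^ count_x w * S (q powi (e * int m)) w)" if "c \<noteq> 0" for c
    using that
  proof (induction m arbitrary: c)
    case 0
    then show ?case by (simp add: S_1 power_count_x_star_unit represents_1)
  next
    case (Suc m)
    let ?f = "\<lambda>w. (c * q ^ m) ^ count_x w * S (q powi e) w"
    let ?g = "\<lambda>w. (c * inverse q) ^ count_x w * S (q powi (e * int m)) w"
    have "c * q powi (int (Suc m) - 1 - 2 * int (Suc j)) =
        (c * inverse q) * q powi (int m - 1 - 2 * int j)" for j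
    proof -
      have "int (Suc m) - 1 - 2 * int (Suc j) = - 1 + (int m - 1 - 2 * int j)" by simp
      then show ?thesis by (simp only: F.Q_add) (simp add: power_int_minus)
    qed
    then have "represents (foldr (fps_qshuffle q)
      (map (\<lambda>j. fps_dilate (- (c * q powi (int (Suc m) - 1 - 2 * int j))) F) [1..<Suc m]) 1) ?g"
      using Suc.IH[of "c * inverse q"] Suc.prems q_nonzero
      by (simp add: map_Suc_upt[symmetric] o_def mult.assoc del: upt_Suc)
    moreover have "represents (fps_dilate (- (c * q ^ m)) F) ?f"
      using represents_dilate[OF F, of "- (c * q ^ m)"]
      by (simp add: mult.assoc[symmetric] power_mult_distrib[symmetric])
    ultimately have "represents (foldr (fps_qshuffle q)
      (map (\<lambda>j. fps_dilate (- (c * q powi (int (Suc m) - 1 - 2 * int j))) F) [0..<Suc m]) 1)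
      (star Q ?f ?g)"
      by (simp add: upt_conv_Cons[of 0] represents_mult[OF q_nonzero] del: upt_Suc)
    moreover have "star Q ?f ?g = (\<lambda>w. c ^ count_x w * S (q powi (e * int (Suc m))) w)"
    proof -
      define f where "f = (\<lambda>w. (q ^ m) ^ count_x w * S (q powi e) w)"
      define g where "g = (\<lambda>w. inverse q ^ count_x w * S (q powi (e * int m)) w)"
      \<comment> \<open>The factor dilated by q^m is \<open>S w\<close> with z = q^m if
        \<open>e = 1\<close>, but \<open>S z\<close> with w = q^-m if \<open>e = - 1\<close>; so the
        two cases use opposite orders of the product formula.\<close>
      have fg: "star Q f g = S (q powi (e * int (Suc m)))"
        using e
      proof
        assume "e = 1"
        moreover have "q powi (1 * int (Suc m)) = q ^ m * q"
          by (simp only: mult_1 power_int_of_nat power_Suc2)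
        ultimately show ?thesis
          using S_mult_swap[of "q ^ m" q] q_nonzero by (simp add: f_def g_def)
      next
        assume "e = - 1"
        then show ?thesis
          using S_mult[of "inverse q" "inverse (q ^ m)"] q_nonzero
          by (simp add: f_def g_def power_int_minus power_int_diff field_simps)
      qed
      have "star Q ?f ?g = star Q (\<lambda>w. c ^ count_x w * f w) (\<lambda>w. c ^ count_x w * g w)"
        by (simp add: f_def g_def power_mult_distrib mult.assoc)
      then show ?thesis by (simp add: star_dilate fun_eq_iff fg)
    qed
    ultimately show ?case by simp
  qed
  from this[of 1] show ?thesis
    by (simp add: dilated_product_def fps_qshuffle_prod_list_def)
qed

end

theorem theorem2p25:
  fixes q :: "'a::field_char_0" and m :: nat
  assumes "q \<noteq> 0"
    and "\<forall>k::nat. k > 0 \<longrightarrow> q ^ k \<noteq> 1"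
    and "m \<ge> 1"
  shows "(\<forall>n.
            fps_nth (dilated_product q m G_tilde) n = catalan_sum q (- 1) m n \<and>
            fps_nth (fps_qshuffle_exp q (- xCy_series q m)) n = catalan_sum q (- 1) m n) \<and>
         (\<forall>n.
            fps_nth (dilated_product q m (D_series q)) n = catalan_sum q 1 m n \<and>
            fps_nth (fps_qshuffle_exp q (xCy_series q m)) n = catalan_sum q 1 m n)"
proof -
  interpret qparam q
    using assms by unfold_locales auto
  have nz: "q powi e \<noteq> 0" for e using assms(1) by simp
  have log0: "logS z w = 0" if "count_x w = 0" for z w using that by (simp add: logS_def)
  have "represents (dilated_product q m G_tilde) (S (q powi (- 1 * int m)))"
    by (rule represents_dilated_product) (use represents_G_tilde in \<open>simp_all add: power_int_minus\<close>)
  then have 1: "dilated_product q m G_tilde = Abs_fps (catalan_sum q (- 1) m)"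
    using represents_catalan_sum by (rule represents_unique)
  have "represents (dilated_product q m (D_series q)) (S (q powi (1 * int m)))"
    by (rule represents_dilated_product) (use represents_D_series in simp_all)
  then have 2: "dilated_product q m (D_series q) = Abs_fps (catalan_sum q 1 m)"
    using represents_catalan_sum by (rule represents_unique)
  have "represents (fps_qshuffle_exp q (xCy_series q m)) (S (q powi (1 * int m)))"
    using represents_exp[OF assms(1) represents_xCy_series log0] S_eq_exp[OF nz, of "int m"] by simp
  then have 3: "fps_qshuffle_exp q (xCy_series q m) = Abs_fps (catalan_sum q 1 m)"
    using represents_catalan_sum by (rule represents_unique)
  \<comment> \<open>Negating the logarithm inverts the parameter q^m.\<close>
  have "represents (- xCy_series q m) (logS (q powi (- 1 * int m)))"
    using represents_uminus[OF represents_xCy_series, of m]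
    by (simp add: power_int_minus logS_inverse)
  then have "represents (fps_qshuffle_exp q (- xCy_series q m)) (S (q powi (- 1 * int m)))"
    unfolding S_eq_exp[OF nz] using log0 by (intro represents_exp[OF assms(1)])
  then have 4: "fps_qshuffle_exp q (- xCy_series q m) = Abs_fps (catalan_sum q (- 1) m)"
    using represents_catalan_sum by (rule represents_unique)
  show ?thesis by (simp add: 1 2 3 4)
qed

end
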